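(* Let $F$ be an algebraically closed field of characteristic not equal to $2$ and $R=F[[x,y]]/(x^2)$. The sequence $$0\to \widetilde R\xrightarrow{\left(\begin{smallmatrix} y\\ x\end{smallmatrix}\right)} \widetilde R\oplus I_{\infty}\xrightarrow{(x,\,-y)} I_{\infty}\to 0$$ is an Auslander--Reiten sequence in the category of all (not necessarily finitely generated) Cohen--Macaulay $R$-modules.
   Context: An $R$-module $N$, not necessarily finitely generated, is called Cohen--Macaulay (CM) if $\mathrm{Hom}_R(F,N)=0$, where $F=R/(x,y)$; equivalently, $ny=0$ with $n\in N$ implies $n=0$. $Q=R[y^{-1}]$ is the total quotient ring of $R$, $\widetilde R=R+xQ$ is the integral closure of $R$ in $Q$, and $I_\infty=xR$. The maps labelled $x$, $y$ are multiplications by these elements; note $x\widetilde R=xR=I_\infty$, so multiplication by $x$ is a map $\widetilde R\to I_\infty$. An Auslander--Reiten (almost split) sequence in the category of CM-modules is a non-split short exact sequence $0\to A\xrightarrow{f}B\xrightarrow{g}C\to0$ of CM-modules with $\mathrm{End}(A)$ and $\mathrm{End}(C)$ local, such that $f$ is left almost split (every morphism $A\to N$ to a CM-module $N$ that is not a split monomorphism factors through $f$) and $g$ is right almost split (every morphism $N\to C$ from a CM-module $N$ that is not a split epimorphism factors through $g$). *)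

theory Defs
  imports
    "HOL-Algebra.Algebra"
    "HOL-Algebra.Algebraic_Closure_Type"
    "HOL-Computational_Algebra.Formal_Power_Series"
begin

section \<open>Modules and almost split sequences\<close>

text \<open>
  Homomorphisms are extensional functions on the carrier, so that equality of functions is
  equality of morphisms and \<^const>\<open>compose\<close> is composition.
\<close>

definition mod_hom ::
    "('r, 'x) ring_scheme \<Rightarrow> ('r, 'a) module \<Rightarrow> ('r, 'b) module \<Rightarrow> ('a \<Rightarrow> 'b) set" where
  "mod_hom R M N = {h \<in> carrier M \<rightarrow>\<^sub>E carrier N.
     (\<forall>a \<in> carrier M. \<forall>b \<in> carrier M. h (a \<oplus>\<^bsub>M\<^esub> b) = h a \<oplus>\<^bsub>N\<^esub> h b) \<and>
     (\<forall>r \<in> carrier R. \<forall>a \<in> carrier M. h (r \<odot>\<^bsub>M\<^esub> a) = r \<odot>\<^bsub>N\<^esub> h a)}"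

definition mod_id :: "('r, 'a) module \<Rightarrow> 'a \<Rightarrow> 'a" where
  "mod_id M = (\<lambda>a \<in> carrier M. a)"

definition mod_zero :: "('r, 'a) module \<Rightarrow> ('r, 'b) module \<Rightarrow> 'a \<Rightarrow> 'b" where
  "mod_zero M N = (\<lambda>a \<in> carrier M. \<zero>\<^bsub>N\<^esub>)"

definition End_ring :: "('r, 'x) ring_scheme \<Rightarrow> ('r, 'a) module \<Rightarrow> ('a \<Rightarrow> 'a) ring" where
  "End_ring R M =
    \<lparr>carrier = mod_hom R M M,
     monoid.mult = (\<lambda>f g. compose (carrier M) f g),
     one = mod_id M,
     ring.zero = mod_zero M M,
     add = (\<lambda>f g. \<lambda>a \<in> carrier M. f a \<oplus>\<^bsub>M\<^esub> g a)\<rparr>"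

text \<open>
  Not necessarily commutative local rings. The zero ring is excluded: there \<open>\<zero>\<close> is a unit, so
  the non-units do not contain \<open>\<zero>\<close>.
\<close>

definition local_ring :: "('a, 'x) ring_scheme \<Rightarrow> bool" where
  "local_ring E \<longleftrightarrow> ring E \<and> ideal (carrier E - Units E) E"

definition split_mono ::
    "('r, 'x) ring_scheme \<Rightarrow> ('r, 'a) module \<Rightarrow> ('r, 'b) module \<Rightarrow> ('a \<Rightarrow> 'b) \<Rightarrow> bool" where
  "split_mono R M N h \<longleftrightarrow>
     h \<in> mod_hom R M N \<and> (\<exists>r \<in> mod_hom R N M. compose (carrier M) r h = mod_id M)"

definition split_epi ::
    "('r, 'x) ring_scheme \<Rightarrow> ('r, 'a) module \<Rightarrow> ('r, 'b) module \<Rightarrow> ('a \<Rightarrow> 'b) \<Rightarrow> bool" where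
  "split_epi R M N h \<longleftrightarrow>
     h \<in> mod_hom R M N \<and> (\<exists>s \<in> mod_hom R N M. compose (carrier N) h s = mod_id N)"

definition short_exact ::
    "('r, 'x) ring_scheme \<Rightarrow> ('r, 'a) module \<Rightarrow> ('a \<Rightarrow> 'b) \<Rightarrow> ('r, 'b) module \<Rightarrow> ('b \<Rightarrow> 'c)
      \<Rightarrow> ('r, 'c) module \<Rightarrow> bool" where
  "short_exact R A f B g C \<longleftrightarrow>
     f \<in> mod_hom R A B \<and> g \<in> mod_hom R B C \<and>
     inj_on f (carrier A) \<and> f ` carrier A = a_kernel B C g \<and> g ` carrier B = carrier C"

definition direct_sum ::
    "('r, 'a) module \<Rightarrow> ('r, 'b) module \<Rightarrow> ('r, 'a \<times> 'b) module" where
  "direct_sum M N =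
    \<lparr>carrier = carrier M \<times> carrier N,
     monoid.mult = (\<lambda>(a, b) (c, d). (a \<otimes>\<^bsub>M\<^esub> c, b \<otimes>\<^bsub>N\<^esub> d)),
     one = (\<one>\<^bsub>M\<^esub>, \<one>\<^bsub>N\<^esub>),
     ring.zero = (\<zero>\<^bsub>M\<^esub>, \<zero>\<^bsub>N\<^esub>),
     add = (\<lambda>(a, b) (c, d). (a \<oplus>\<^bsub>M\<^esub> c, b \<oplus>\<^bsub>N\<^esub> d)),
     module.smult = (\<lambda>r (a, b). (r \<odot>\<^bsub>M\<^esub> a, r \<odot>\<^bsub>N\<^esub> b))\<rparr>"

text \<open>A ring \<open>S\<close> as a module over the source of a ring homomorphism \<open>\<phi>\<close> into \<open>S\<close>.\<close>

definition module_via :: "('r \<Rightarrow> 's) \<Rightarrow> ('s, 'x) ring_scheme \<Rightarrow> ('r, 's) module" where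
  "module_via \<phi> S =
    \<lparr>carrier = carrier S, monoid.mult = monoid.mult S, one = monoid.one S, ring.zero = ring.zero S, add = ring.add S,
     module.smult = (\<lambda>r s. \<phi> r \<otimes>\<^bsub>S\<^esub> s)\<rparr>"


section \<open>Localization of a commutative ring\<close>

definition frac_rel :: "('a, 'x) ring_scheme \<Rightarrow> 'a set \<Rightarrow> (('a \<times> 'a) \<times> ('a \<times> 'a)) set" where
  "frac_rel R S =
    {((a, s), (b, t)). a \<in> carrier R \<and> b \<in> carrier R \<and> s \<in> S \<and> t \<in> S \<and>
       (\<exists>u \<in> S. u \<otimes>\<^bsub>R\<^esub> (a \<otimes>\<^bsub>R\<^esub> t) = u \<otimes>\<^bsub>R\<^esub> (b \<otimes>\<^bsub>R\<^esub> s))}"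

definition loc_frac :: "('a, 'x) ring_scheme \<Rightarrow> 'a set \<Rightarrow> 'a \<Rightarrow> 'a \<Rightarrow> ('a \<times> 'a) set" where
  "loc_frac R S a s = frac_rel R S `` {(a, s)}"

definition localization :: "('a, 'x) ring_scheme \<Rightarrow> 'a set \<Rightarrow> ('a \<times> 'a) set ring" where
  "localization R S =
    \<lparr>carrier = (carrier R \<times> S) // frac_rel R S,
     monoid.mult = (\<lambda>p q. \<Union>(a, s) \<in> p. \<Union>(b, t) \<in> q. loc_frac R S (a \<otimes>\<^bsub>R\<^esub> b) (s \<otimes>\<^bsub>R\<^esub> t)),
     one = loc_frac R S \<one>\<^bsub>R\<^esub> \<one>\<^bsub>R\<^esub>,
     ring.zero = loc_frac R S \<zero>\<^bsub>R\<^esub> \<one>\<^bsub>R\<^esub>,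
     add = (\<lambda>p q. \<Union>(a, s) \<in> p. \<Union>(b, t) \<in> q.
              loc_frac R S (a \<otimes>\<^bsub>R\<^esub> t \<oplus>\<^bsub>R\<^esub> b \<otimes>\<^bsub>R\<^esub> s) (s \<otimes>\<^bsub>R\<^esub> t))\<rparr>"


context
  fixes R (structure) and S
  assumes R: "cring R" and S: "S \<subseteq> carrier R" "\<one> \<in> S" and SM: "\<And>s t. s \<in> S \<Longrightarrow> t \<in> S \<Longrightarrow> s \<otimes> t \<in> S"
begin
interpretation cring R by (rule R)

lemma loc_frac_equiv: "equiv (carrier R \<times> S) (frac_rel R S)"
proof (rule equivI)
  show "frac_rel R S \<subseteq> (carrier R \<times> S) \<times> carrier R \<times> S" by (auto simp: frac_rel_def)
  show "refl_on (carrier R \<times> S) (frac_rel R S)" using S by (auto simp: refl_on_def frac_rel_def)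
  show "sym (frac_rel R S)" by (auto simp: sym_def frac_rel_def) metis
  show "trans (frac_rel R S)"
  proof (rule transI, clarsimp simp: frac_rel_def)
    fix a s b t c v u w
    assume *: "a \<in> carrier R" "b \<in> carrier R" "c \<in> carrier R" "s \<in> S" "t \<in> S" "v \<in> S" "u \<in> S" "w \<in> S"
      and 1: "u \<otimes> (a \<otimes> t) = u \<otimes> (b \<otimes> s)" and 2: "w \<otimes> (b \<otimes> v) = w \<otimes> (c \<otimes> t)"
    note cc = *(1-3) *(4-)[THEN subsetD[OF S(1)]]
    have "(u \<otimes> w \<otimes> t) \<otimes> (a \<otimes> v) = (u \<otimes> (a \<otimes> t)) \<otimes> (w \<otimes> v)" using cc by (simp add: m_ac)
    also have "\<dots> = (w \<otimes> (b \<otimes> v)) \<otimes> (u \<otimes> s)" unfolding 1 using cc by (simp add: m_ac)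
    also have "\<dots> = (u \<otimes> w \<otimes> t) \<otimes> (c \<otimes> s)" unfolding 2 using cc by (simp add: m_ac)
    finally show "\<exists>u\<in>S. u \<otimes> (a \<otimes> v) = u \<otimes> (c \<otimes> s)" using * SM by blast
  qed
qed

lemma loc_frac_eq: "\<lbrakk>a \<in> carrier R; b \<in> carrier R; s \<in> S; t \<in> S\<rbrakk> \<Longrightarrow>
   loc_frac R S a s = loc_frac R S b t \<longleftrightarrow> (\<exists>u\<in>S. u \<otimes> (a \<otimes> t) = u \<otimes> (b \<otimes> s))"
  unfolding loc_frac_def using eq_equiv_class_iff[OF loc_frac_equiv, of "(a,s)" "(b,t)"]
  by (auto simp: frac_rel_def)

lemma loc_frac_mult: assumes "a \<in> carrier R" "b \<in> carrier R" "s \<in> S" "t \<in> S"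
  shows "loc_frac R S a s \<otimes>\<^bsub>localization R S\<^esub> loc_frac R S b t = loc_frac R S (a \<otimes> b) (s \<otimes> t)"
proof -
  have "congruent2 (frac_rel R S) (frac_rel R S) (\<lambda>p q. loc_frac R S (fst p \<otimes> fst q) (snd p \<otimes> snd q))"
  proof (rule congruent2I[OF loc_frac_equiv loc_frac_equiv]; clarsimp)
    fix a s b t c v assume "((a,s),(b,t)) \<in> frac_rel R S" and c: "c \<in> carrier R" "v \<in> S"
    then obtain u where *: "a \<in> carrier R" "b \<in> carrier R" "s \<in> S" "t \<in> S" "u \<in> S" and 1: "u \<otimes> (a \<otimes> t) = u \<otimes> (b \<otimes> s)"
      by (auto simp: frac_rel_def)
    note cc = *(1-2) c(1) *(3-)[THEN subsetD[OF S(1)]] c(2)[THEN subsetD[OF S(1)]]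
    have "u \<otimes> (a \<otimes> c \<otimes> (t \<otimes> v)) = (u \<otimes> (a \<otimes> t)) \<otimes> (c \<otimes> v)" using cc by (simp add: m_ac)
    also have "\<dots> = u \<otimes> (b \<otimes> c \<otimes> (s \<otimes> v))" unfolding 1 using cc by (simp add: m_ac)
    finally show "loc_frac R S (a \<otimes> c) (s \<otimes> v) = loc_frac R S (b \<otimes> c) (t \<otimes> v)"
      using * c SM by (subst loc_frac_eq) auto
    then show "loc_frac R S (c \<otimes> a) (v \<otimes> s) = loc_frac R S (c \<otimes> b) (v \<otimes> t)"
      using cc by (simp add: m_comm)
  qed
  from UN_equiv_class2[OF loc_frac_equiv loc_frac_equiv this, of "(a,s)" "(b,t)"] assms
  show ?thesis by (simp add: localization_def loc_frac_def split_def)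
qed

lemma loc_frac_add: assumes "a \<in> carrier R" "b \<in> carrier R" "s \<in> S" "t \<in> S"
  shows "loc_frac R S a s \<oplus>\<^bsub>localization R S\<^esub> loc_frac R S b t = loc_frac R S (a \<otimes> t \<oplus> b \<otimes> s) (s \<otimes> t)"
proof -
  have "congruent2 (frac_rel R S) (frac_rel R S) (\<lambda>p q. loc_frac R S (fst p \<otimes> snd q \<oplus> fst q \<otimes> snd p) (snd p \<otimes> snd q))"
  proof (rule congruent2I[OF loc_frac_equiv loc_frac_equiv]; clarsimp)
    fix a s b t c v assume "((a,s),(b,t)) \<in> frac_rel R S" and c: "c \<in> carrier R" "v \<in> S"
    then obtain u where *: "a \<in> carrier R" "b \<in> carrier R" "s \<in> S" "t \<in> S" "u \<in> S" and 1: "u \<otimes> (a \<otimes> t) = u \<otimes> (b \<otimes> s)"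
      by (auto simp: frac_rel_def)
    note cc = *(1-2) c(1) *(3-)[THEN subsetD[OF S(1)]] c(2)[THEN subsetD[OF S(1)]]
    have "u \<otimes> ((a \<otimes> v \<oplus> c \<otimes> s) \<otimes> (t \<otimes> v)) = (u \<otimes> (a \<otimes> t)) \<otimes> (v \<otimes> v) \<oplus> u \<otimes> (c \<otimes> s \<otimes> t \<otimes> v)"
      using cc by (simp add: m_ac l_distr r_distr)
    also have "\<dots> = u \<otimes> ((b \<otimes> v \<oplus> c \<otimes> t) \<otimes> (s \<otimes> v))" unfolding 1 using cc by (simp add: m_ac l_distr r_distr)
    finally show "loc_frac R S (a \<otimes> v \<oplus> c \<otimes> s) (s \<otimes> v) = loc_frac R S (b \<otimes> v \<oplus> c \<otimes> t) (t \<otimes> v)"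
      using *(3-) c(2) cc SM by (intro loc_frac_eq[THEN iffD2] bexI[of _ u] a_closed m_closed) simp_all
    then show "loc_frac R S (c \<otimes> s \<oplus> a \<otimes> v) (v \<otimes> s) = loc_frac R S (c \<otimes> t \<oplus> b \<otimes> v) (v \<otimes> t)"
      using cc by (simp add: m_comm a_comm)
  qed
  from UN_equiv_class2[OF loc_frac_equiv loc_frac_equiv this, of "(a,s)" "(b,t)"] assms
  show ?thesis by (simp add: localization_def loc_frac_def split_def)
qed
end


section \<open>The ring \<open>F[[x,y]]/(x\<^sup>2)\<close>\<close>

text \<open>
  \<open>F[[x,y]]\<close> is \<open>F[[y]][[x]]\<close>: the outer power series variable is \<open>x\<close>, the inner one is \<open>y\<close>.
\<close>

type_synonym 'k rxy = "'k fps fps set"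
type_synonym 'k qxy = "('k rxy \<times> 'k rxy) set"

abbreviation P_ring :: "'k::field fps fps ring" where
  "P_ring \<equiv> ring_of_type_algebra"

definition P_x :: "'k::field fps fps" where "P_x = fps_X"
definition P_y :: "'k::field fps fps" where "P_y = fps_const fps_X"

definition R_proj :: "'k::field fps fps \<Rightarrow> 'k rxy" where
  "R_proj p = PIdl\<^bsub>P_ring\<^esub> (P_x ^ 2) +>\<^bsub>P_ring\<^esub> p"

definition R_ring :: "'k::field rxy ring" where
  "R_ring = P_ring Quot (PIdl\<^bsub>P_ring\<^esub> (P_x ^ 2))"

definition R_x :: "'k::field rxy" where "R_x = R_proj P_x"
definition R_y :: "'k::field rxy" where "R_y = R_proj P_y"

definition F_module :: "('k::field rxy, 'k rxy set) module" where
  "F_module = (let J = Idl\<^bsub>R_ring\<^esub> {R_x, R_y} in module_via (\<lambda>r. J +>\<^bsub>R_ring\<^esub> r) (R_ring Quot J))"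

definition CM_module :: "('k::field rxy, 'n) module \<Rightarrow> bool" where
  "CM_module N \<longleftrightarrow> module R_ring N \<and> mod_hom R_ring F_module N = {mod_zero F_module N}"

lemma P_ring_cring: "cring (P_ring :: 'k::field fps fps ring)" by (rule cring_from_type_algebra)

lemma R_ring_cring: "cring (R_ring :: 'k::field rxy ring)"
proof -
  interpret P: cring "P_ring :: 'k fps fps ring" by (rule P_ring_cring)
  have "ideal (PIdl\<^bsub>P_ring\<^esub> (P_x ^ 2 :: 'k fps fps)) P_ring"
    by (rule P.cgenideal_ideal) (simp add: ring_of_type_algebra_def)
  then show ?thesis unfolding R_ring_def
    by (simp add: ideal.quotient_is_cring P_ring_cring)
qed

lemma R_xy_closed: "(R_x :: 'k::field rxy) \<in> carrier R_ring" "(R_y :: 'k::field rxy) \<in> carrier R_ring"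
  by (auto simp: R_x_def R_y_def R_proj_def R_ring_def FactRing_def A_RCOSETS_def' ring_of_type_algebra_def)

lemma CM_module_iff:
  fixes N :: "('k::field rxy, 'n) module"
  assumes "module R_ring N"
  shows "CM_module N \<longleftrightarrow> (\<forall>n \<in> carrier N. R_y \<odot>\<^bsub>N\<^esub> n = \<zero>\<^bsub>N\<^esub> \<longrightarrow> n = \<zero>\<^bsub>N\<^esub>)"
proof -
  interpret R: cring "R_ring :: 'k rxy ring" by (rule R_ring_cring)
  interpret N: module R_ring N by fact
  note xy = R_xy_closed[where 'k = 'k]
  define J where "J = Idl\<^bsub>R_ring\<^esub> {R_x, R_y :: 'k rxy}"
  have idJ: "ideal J R_ring" unfolding J_def by (rule R.genideal_ideal) (use xy in auto)
  interpret J: ideal J R_ring by fact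
  have Jxy: "R_x \<in> J" "R_y \<in> J" unfolding J_def using R.genideal_self[of "{R_x,R_y}"] xy by auto
  let ?q = "\<lambda>r. J +>\<^bsub>R_ring\<^esub> r"
  have F: "F_module = module_via ?q (R_ring Quot J)" by (simp add: F_module_def J_def Let_def)
  have cF: "carrier F_module = ?q ` carrier R_ring"
    by (auto simp: F module_via_def FactRing_def A_RCOSETS_def')
  have aF: "?q a \<oplus>\<^bsub>F_module\<^esub> ?q b = ?q (a \<oplus>\<^bsub>R_ring\<^esub> b)" if "a \<in> carrier R_ring" "b \<in> carrier R_ring" for a b
    using that J.a_rcos_sum by (simp add: F module_via_def FactRing_def)
  have sF: "r \<odot>\<^bsub>F_module\<^esub> ?q b = ?q (r \<otimes>\<^bsub>R_ring\<^esub> b)" if "r \<in> carrier R_ring" "b \<in> carrier R_ring" for r b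
    using that J.rcoset_mult_add by (simp add: F module_via_def FactRing_def)
  have zF: "?q j = ?q \<zero>\<^bsub>R_ring\<^esub>" if "j \<in> J" for j
    using that by (metis J.a_rcos_const J.zero_closed)
  have z: "mod_zero F_module N \<in> mod_hom R_ring F_module N"
    using aF sF by (auto simp: mod_zero_def mod_hom_def cF)
  have x2: "R_x \<otimes>\<^bsub>R_ring\<^esub> R_x = (\<zero>\<^bsub>R_ring\<^esub> :: 'k rxy)"
  proof -
    interpret P: cring "P_ring :: 'k fps fps ring" by (rule P_ring_cring)
    interpret I: ideal "PIdl\<^bsub>P_ring\<^esub> (P_x ^ 2 :: 'k fps fps)" P_ring
      by (rule P.cgenideal_ideal) (simp add: ring_of_type_algebra_def)
    have "P_x * P_x \<in> PIdl\<^bsub>P_ring\<^esub> (P_x ^ 2 :: 'k fps fps)"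
      using P.cgenideal_self[of "P_x^2"] by (simp add: ring_of_type_algebra_def power2_eq_square)
    then show ?thesis using I.rcoset_mult_add[of P_x P_x] I.a_rcos_const
      by (simp add: R_x_def R_proj_def R_ring_def FactRing_def ring_of_type_algebra_def)
  qed
  show ?thesis
  proof
    assume CM: "CM_module N"
    have both: "n = \<zero>\<^bsub>N\<^esub>" if n: "n \<in> carrier N" "R_y \<odot>\<^bsub>N\<^esub> n = \<zero>\<^bsub>N\<^esub>" "R_x \<odot>\<^bsub>N\<^esub> n = \<zero>\<^bsub>N\<^esub>" for n
    proof -
      have "ideal {r \<in> carrier R_ring. r \<odot>\<^bsub>N\<^esub> n = \<zero>\<^bsub>N\<^esub>} R_ring"
      proof (rule idealI[OF R.ring_axioms])
        show "subgroup {r \<in> carrier R_ring. r \<odot>\<^bsub>N\<^esub> n = \<zero>\<^bsub>N\<^esub>} (add_monoid R_ring)"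
        proof (rule R.add.subgroupI)
          show "{r \<in> carrier R_ring. r \<odot>\<^bsub>N\<^esub> n = \<zero>\<^bsub>N\<^esub>} \<noteq> {}"
            using N.smult_l_null[OF n(1)] by blast
        qed (auto simp: N.smult_l_distr N.smult_l_minus n(1))
      next
        fix a r :: "'k rxy"
        assume "a \<in> {r \<in> carrier R_ring. r \<odot>\<^bsub>N\<^esub> n = \<zero>\<^bsub>N\<^esub>}" and r: "r \<in> carrier R_ring"
        then have a: "a \<in> carrier R_ring" "a \<odot>\<^bsub>N\<^esub> n = \<zero>\<^bsub>N\<^esub>" by auto
        show ra: "r \<otimes>\<^bsub>R_ring\<^esub> a \<in> {r \<in> carrier R_ring. r \<odot>\<^bsub>N\<^esub> n = \<zero>\<^bsub>N\<^esub>}"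
          using a r n(1) by (simp add: N.smult_assoc1)
        show "a \<otimes>\<^bsub>R_ring\<^esub> r \<in> {r \<in> carrier R_ring. r \<odot>\<^bsub>N\<^esub> n = \<zero>\<^bsub>N\<^esub>}"
          using ra R.m_comm[OF a(1) r] by simp
      qed
      then have Jn: "r \<odot>\<^bsub>N\<^esub> n = \<zero>\<^bsub>N\<^esub>" if "r \<in> J" for r
        using R.genideal_minimal[of "{r \<in> carrier R_ring. r \<odot>\<^bsub>N\<^esub> n = \<zero>\<^bsub>N\<^esub>}" "{R_x,R_y}"] that n xy
        unfolding J_def by auto
      define h where "h = (\<lambda>c \<in> carrier F_module. (SOME r. r \<in> c) \<odot>\<^bsub>N\<^esub> n)"
      have h: "h (?q r) = r \<odot>\<^bsub>N\<^esub> n" if r: "r \<in> carrier R_ring" for r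
      proof -
        have "r \<in> ?q r" using r by (rule J.a_rcos_self)
        then have "(SOME s. s \<in> ?q r) \<in> ?q r" by (rule someI)
        then obtain j where "j \<in> J" "(SOME s. s \<in> ?q r) = j \<oplus>\<^bsub>R_ring\<^esub> r"
          by (auto simp: a_r_coset_def')
        then show ?thesis using r n Jn by (simp add: h_def cF N.smult_l_distr)
      qed
      have "h \<in> mod_hom R_ring F_module N"
        unfolding mod_hom_def
      proof (intro CollectI conjI ballI PiE_I)
        show "h c \<in> carrier N" if "c \<in> carrier F_module" for c using that h n by (auto simp: cF)
        show "h c = undefined" if "c \<notin> carrier F_module" for c using that by (simp add: h_def)
        show "h (a \<oplus>\<^bsub>F_module\<^esub> b) = h a \<oplus>\<^bsub>N\<^esub> h b" if "a \<in> carrier F_module" "b \<in> carrier F_module" for a b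
          using that aF h n by (auto simp: cF N.smult_l_distr)
        show "h (r \<odot>\<^bsub>F_module\<^esub> b) = r \<odot>\<^bsub>N\<^esub> h b" if "r \<in> carrier R_ring" "b \<in> carrier F_module" for r b
          using that sF h n by (auto simp: cF N.smult_assoc1)
      qed
      then have "h = mod_zero F_module N" using CM by (auto simp: CM_module_def)
      then have "h (?q \<one>\<^bsub>R_ring\<^esub>) = \<zero>\<^bsub>N\<^esub>" by (simp add: mod_zero_def cF)
      then show ?thesis using h n by simp
    qed
    show "\<forall>n \<in> carrier N. R_y \<odot>\<^bsub>N\<^esub> n = \<zero>\<^bsub>N\<^esub> \<longrightarrow> n = \<zero>\<^bsub>N\<^esub>"
    proof (intro ballI impI)
      fix n assume n: "n \<in> carrier N" "R_y \<odot>\<^bsub>N\<^esub> n = \<zero>\<^bsub>N\<^esub>"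
      have "R_x \<odot>\<^bsub>N\<^esub> n = \<zero>\<^bsub>N\<^esub>"
      proof (rule both)
        show "R_x \<odot>\<^bsub>N\<^esub> n \<in> carrier N" using n xy by simp
        show "R_y \<odot>\<^bsub>N\<^esub> (R_x \<odot>\<^bsub>N\<^esub> n) = \<zero>\<^bsub>N\<^esub>"
          by (metis N.smult_assoc1 N.smult_r_null R.m_comm xy n)
        show "R_x \<odot>\<^bsub>N\<^esub> (R_x \<odot>\<^bsub>N\<^esub> n) = \<zero>\<^bsub>N\<^esub>"
          using x2 n xy by (simp flip: N.smult_assoc1)
      qed
      then show "n = \<zero>\<^bsub>N\<^esub>" using both n by blast
    qed
  next
    assume y: "\<forall>n \<in> carrier N. R_y \<odot>\<^bsub>N\<^esub> n = \<zero>\<^bsub>N\<^esub> \<longrightarrow> n = \<zero>\<^bsub>N\<^esub>"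
    have "h = mod_zero F_module N" if h: "h \<in> mod_hom R_ring F_module N" for h
    proof
      fix c
      have hz: "h (?q \<zero>\<^bsub>R_ring\<^esub>) = \<zero>\<^bsub>N\<^esub>"
      proof -
        have "h (\<zero>\<^bsub>R_ring\<^esub> \<odot>\<^bsub>F_module\<^esub> ?q \<zero>\<^bsub>R_ring\<^esub>) = \<zero>\<^bsub>R_ring\<^esub> \<odot>\<^bsub>N\<^esub> h (?q \<zero>\<^bsub>R_ring\<^esub>)"
          and "h (?q \<zero>\<^bsub>R_ring\<^esub>) \<in> carrier N"
          using h by (auto simp: mod_hom_def cF)
        then show ?thesis by (simp add: sF)
      qed
      have "h (?q r) = \<zero>\<^bsub>N\<^esub>" if r: "r \<in> carrier R_ring" for r
      proof -
        have "h (R_y \<odot>\<^bsub>F_module\<^esub> ?q r) = R_y \<odot>\<^bsub>N\<^esub> h (?q r)" and c: "h (?q r) \<in> carrier N"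
          using h r xy by (auto simp: mod_hom_def cF)
        moreover have "R_y \<odot>\<^bsub>F_module\<^esub> ?q r = ?q \<zero>\<^bsub>R_ring\<^esub>"
          using sF[OF xy(2) r] zF[OF J.I_r_closed[OF Jxy(2) r]] by (rule trans)
        ultimately show ?thesis using y hz by metis
      qed
      then have "h c = \<zero>\<^bsub>N\<^esub>" if "c \<in> carrier F_module"
        using that unfolding cF by blast
      moreover have "h c = undefined" if "c \<notin> carrier F_module"
      proof -
        have "h \<in> carrier F_module \<rightarrow>\<^sub>E carrier N" using h unfolding mod_hom_def by blast
        then show ?thesis using that by (rule PiE_arb)
      qed
      ultimately show "h c = mod_zero F_module N c" by (simp add: mod_zero_def)
    qed
    then have "mod_hom R_ring F_module N = {mod_zero F_module N}" using z by blast
    then show "CM_module N" using assms by (simp add: CM_module_def)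
  qed
qed

definition y_powers :: "'k::field rxy set" where
  "y_powers = {R_y [^]\<^bsub>R_ring\<^esub> n | n :: nat. True}"

definition Q_ring :: "'k::field qxy ring" where
  "Q_ring = localization R_ring y_powers"

definition R_to_Q :: "'k::field rxy \<Rightarrow> 'k qxy" where
  "R_to_Q r = loc_frac R_ring y_powers r \<one>\<^bsub>R_ring\<^esub>"

definition Q_module :: "('k::field rxy, 'k qxy) module" where
  "Q_module = module_via R_to_Q Q_ring"

text \<open>\<open>R + xQ\<close> and \<open>xR\<close>, both as \<open>R\<close>-submodules of \<open>Q\<close>.\<close>

definition R_tilde :: "('k::field rxy, 'k qxy) module" where
  "R_tilde = Q_module\<lparr>carrier :=
     R_to_Q ` carrier R_ring <+>\<^bsub>Q_ring\<^esub> (R_to_Q R_x <#\<^bsub>Q_ring\<^esub> carrier Q_ring)\<rparr>"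

definition I_infty :: "('k::field rxy, 'k qxy) module" where
  "I_infty = Q_module\<lparr>carrier := R_to_Q R_x <#\<^bsub>Q_ring\<^esub> (R_to_Q ` carrier R_ring)\<rparr>"


section \<open>Almost split sequences of Cohen--Macaulay modules\<close>

text \<open>
  A formula cannot quantify over types, so the type \<open>'n\<close> carrying the test modules \<open>N\<close> is a
  parameter. In a theorem stated for a type variable \<open>'n\<close> the test modules range over all
  Cohen--Macaulay modules on arbitrary carriers.
\<close>

definition left_almost_split ::
    "'n itself \<Rightarrow> ('k::field rxy, 'a) module \<Rightarrow> ('k rxy, 'b) module \<Rightarrow> ('a \<Rightarrow> 'b) \<Rightarrow> bool" where
  "left_almost_split _ A B f \<longleftrightarrow>
     (\<forall>N :: ('k rxy, 'n) module. CM_module N \<longrightarrow>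
       (\<forall>h \<in> mod_hom R_ring A N. \<not> split_mono R_ring A N h \<longrightarrow>
         (\<exists>u \<in> mod_hom R_ring B N. h = compose (carrier A) u f)))"

definition right_almost_split ::
    "'n itself \<Rightarrow> ('k::field rxy, 'b) module \<Rightarrow> ('k rxy, 'c) module \<Rightarrow> ('b \<Rightarrow> 'c) \<Rightarrow> bool" where
  "right_almost_split _ B C g \<longleftrightarrow>
     (\<forall>N :: ('k rxy, 'n) module. CM_module N \<longrightarrow>
       (\<forall>h \<in> mod_hom R_ring N C. \<not> split_epi R_ring N C h \<longrightarrow>
         (\<exists>u \<in> mod_hom R_ring N B. h = compose (carrier N) g u)))"

definition AR_sequence ::
    "'n itself \<Rightarrow> ('k::field rxy, 'a) module \<Rightarrow> ('a \<Rightarrow> 'b) \<Rightarrow> ('k rxy, 'b) module \<Rightarrow> ('b \<Rightarrow> 'c)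
      \<Rightarrow> ('k rxy, 'c) module \<Rightarrow> bool" where
  "AR_sequence n A f B g C \<longleftrightarrow>
     CM_module A \<and> CM_module B \<and> CM_module C \<and>
     short_exact R_ring A f B g C \<and> \<not> split_epi R_ring B C g \<and>
     local_ring (End_ring R_ring A) \<and> local_ring (End_ring R_ring C) \<and>
     left_almost_split n A B f \<and> right_almost_split n B C g"

end

theory Submission
  imports Defs "HOL-Computational_Algebra.Formal_Laurent_Series"
begin

text \<open>
  Write \<open>V = k[[y]]\<close> and \<open>L = k((y))\<close>, so that \<open>R = V + xV\<close>, \<open>Q = L + xL\<close>, \<open>R_tilde = V + xL\<close> and
  \<open>I_infty = xV\<close>. Everything rests on one lifting property of a CM-module \<open>N\<close>: a \<open>k\<close>-linear map
  \<open>\<phi> : N \<rightarrow> k\<close> that kills \<open>(x, y)N\<close> and the submodule \<open>K = {n. x n = 0}\<close> is the residue of some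
  \<open>R\<close>-homomorphism \<open>r : N \<rightarrow> R_tilde\<close>. Since \<open>N/K\<close> is torsion free over \<open>V\<close>, the map \<open>\<phi>\<close> lifts one
  coefficient at a time to a \<open>V\<close>-linear \<open>\<alpha> : N \<rightarrow> V\<close> vanishing on \<open>K\<close>; the map \<open>x n \<mapsto> \<alpha> n\<close> extends to a
  \<open>V\<close>-linear \<open>\<beta> : N \<rightarrow> L\<close> because \<open>L\<close> is injective over \<open>V\<close>; and \<open>r = \<alpha> + x \<beta>\<close>.

  If \<open>h : N \<rightarrow> I_infty\<close> is not a split epimorphism, the residue of \<open>h/x\<close> vanishes on \<open>K\<close>; for a lift \<open>r\<close> of
  it \<open>x r - h\<close> is divisible by \<open>y\<close>, and \<open>(r, (x r - h)/y)\<close> is the factorization of \<open>h\<close>. If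
  \<open>h : R_tilde \<rightarrow> N\<close> is not a split monomorphism, no lift \<open>r\<close> makes \<open>r (h 1)\<close> a unit, so \<open>h 1 = k + y n\<close>
  with \<open>k \<in> K\<close>, and \<open>(a + x d, x e) \<mapsto> a n + h (x d/y) + e k\<close> is the factorization of \<open>h\<close>.
\<close>

section \<open>Explicit arithmetic in \<open>R\<close> and \<open>Q\<close>\<close>

text \<open>These rules turn divisions by powers of \<open>y\<close> into shifts, which field arithmetic cannot cancel.\<close>

declare fls_divide_X [simp del] fls_divide_X_power [simp del]

text \<open>Normal form for \<open>R\<close>: modulo \<open>x^2\<close> every series in
  \<open>x\<close> reduces to \<open>a + b x\<close> with \<open>a\<close>, \<open>b\<close> in
  \<open>k[[y]]\<close>, in exactly one way.\<close>

definition rr :: "'k::field fps \<Rightarrow> 'k fps \<Rightarrow> 'k rxy" where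
  "rr a b = R_proj (fps_const a + fps_const b * P_x)"

section \<open>Elements of \<open>R\<close> as pairs of power series in \<open>y\<close>\<close>

lemma P_ring_simps:
  "carrier P_ring = UNIV" "a \<oplus>\<^bsub>P_ring\<^esub> b = a + b" "a \<otimes>\<^bsub>P_ring\<^esub> b = a * b"
  "\<zero>\<^bsub>P_ring\<^esub> = 0" "\<one>\<^bsub>P_ring\<^esub> = 1"
  by (simp_all add: ring_of_type_algebra_def)

lemma P_ideal: "ideal (PIdl\<^bsub>P_ring\<^esub> (P_x ^ 2 :: 'k::field fps fps)) P_ring"
  by (rule cring.cgenideal_ideal[OF P_ring_cring]) (simp add: P_ring_simps)

lemma P_x_square_dvd_iff: "P_x ^ 2 dvd p \<longleftrightarrow> p $ 0 = 0 \<and> p $ 1 = 0"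
proof
  assume "p $ 0 = 0 \<and> p $ 1 = 0"
  \<comment> \<open>The coefficients at 0 and 1 vanish by assumption; from index 2 on, the factor
    \<open>P_x ^ 2\<close> undoes the shift.\<close>
  then have "p $ n = (P_x ^ 2 * fps_shift 2 p) $ n" for n
    by (cases n; cases "n - 1") (auto simp: P_x_def fps_X_power_mult_nth)
  then have "p = P_x ^ 2 * fps_shift 2 p" by (rule fps_ext)
  then show "P_x ^ 2 dvd p" by (rule dvdI)
qed (auto simp: P_x_def fps_X_power_mult_nth elim!: dvdE)

text \<open>Only the two lowest \<open>x\<close>-coefficients survive modulo \<open>x^2\<close>.
  With the coset written as a plain set of series, equality in \<open>R\<close> becomes comparison
  of these coefficients.\<close>

lemma R_proj_eq: "R_proj p = {q. q $ 0 = p $ 0 \<and> q $ 1 = p $ 1}"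
proof -
  have "PIdl\<^bsub>P_ring\<^esub> (P_x ^ 2 :: 'a fps fps) = {h. P_x ^ 2 dvd h}"
    by (auto simp: cgenideal_def P_ring_simps dvd_def mult.commute)
  then have "R_proj p = {h + p | h. P_x ^ 2 dvd h}"
    by (auto simp: R_proj_def a_r_coset_def' P_ring_simps)
  also have "\<dots> = {q. P_x ^ 2 dvd q - p}"
    by (metis (no_types, opaque_lifting) add_diff_cancel_right' diff_add_cancel)
  finally show ?thesis by (simp add: P_x_square_dvd_iff)
qed

lemma R_proj_eq_iff: "R_proj p = R_proj q \<longleftrightarrow> p $ 0 = q $ 0 \<and> p $ 1 = q $ 1"
  by (auto simp: R_proj_eq)

lemma R_proj_eq_rr: "R_proj p = rr (p $ 0) (p $ 1)"
  by (simp add: rr_def R_proj_eq_iff P_x_def)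

lemma rr_eq_iff [simp]: "rr a b = rr c d \<longleftrightarrow> a = c \<and> b = d"
  by (simp add: rr_def R_proj_eq_iff P_x_def)

lemma R_carrier: "carrier R_ring = {rr a b | a b. True}"
proof -
  have "carrier R_ring = range (R_proj :: 'a fps fps \<Rightarrow> _)"
    by (auto simp: R_ring_def R_proj_def FactRing_def A_RCOSETS_def' P_ring_simps)
  moreover have "rr a b \<in> range R_proj" for a b :: "'a fps" by (simp add: rr_def)
  ultimately show ?thesis by (auto simp: R_proj_eq_rr)
qed

lemma rr_closed [simp]: "rr a b \<in> carrier R_ring"
  by (auto simp: R_carrier)

lemma rr_add [simp]: "rr a b \<oplus>\<^bsub>R_ring\<^esub> rr c d = rr (a + c) (b + d)"
proof -
  interpret I: ideal "PIdl\<^bsub>P_ring\<^esub> (P_x ^ 2 :: 'a fps fps)" P_ring by (rule P_ideal)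
  have "R_proj p \<oplus>\<^bsub>R_ring\<^esub> R_proj q = R_proj (p + q)" for p q :: "'a fps fps"
    using I.a_rcos_sum[of p q] by (simp add: R_proj_def R_ring_def FactRing_def P_ring_simps)
  then show ?thesis by (simp add: rr_def R_proj_eq_iff P_x_def)
qed

lemma rr_mult [simp]: "rr a b \<otimes>\<^bsub>R_ring\<^esub> rr c d = rr (a * c) (a * d + b * c)"
proof -
  interpret I: ideal "PIdl\<^bsub>P_ring\<^esub> (P_x ^ 2 :: 'a fps fps)" P_ring by (rule P_ideal)
  have "R_proj p \<otimes>\<^bsub>R_ring\<^esub> R_proj q = R_proj (p * q)" for p q :: "'a fps fps"
    using I.rcoset_mult_add[of p q] by (simp add: R_proj_def R_ring_def FactRing_def P_ring_simps)
  then show ?thesis by (simp add: rr_def R_proj_eq_iff P_x_def fps_mult_nth_1 fps_mult_nth_0)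
qed

lemma R_zero: "\<zero>\<^bsub>R_ring\<^esub> = rr 0 0"
proof -
  interpret cring "R_ring :: 'a rxy ring" by (rule R_ring_cring)
  \<comment> \<open>In an additive group \<open>z + z = z\<close> forces
    \<open>z = 0\<close>.\<close>
  have "rr 0 0 \<oplus>\<^bsub>R_ring\<^esub> rr 0 0 = (rr 0 0 :: 'a rxy)" by simp
  then show ?thesis using add.l_cancel_one[of "rr 0 0 :: 'a rxy" "rr 0 0"] by simp
qed

lemma R_one: "\<one>\<^bsub>R_ring\<^esub> = rr 1 0"
proof -
  have "\<one>\<^bsub>R_ring\<^esub> = R_proj (1 :: 'a fps fps)"
    by (simp add: R_proj_def R_ring_def FactRing_def P_ring_simps)
  then show ?thesis by (simp add: R_proj_eq_rr)
qed

lemma R_x_eq: "R_x = rr 0 1" and R_y_eq: "R_y = rr fps_X 0"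
  by (simp_all add: R_x_def R_y_def R_proj_eq_rr P_x_def P_y_def)

lemma rr_minus [simp]: "\<ominus>\<^bsub>R_ring\<^esub> rr a b = rr (- a) (- b)"
proof -
  interpret cring "R_ring :: 'a rxy ring" by (rule R_ring_cring)
  show ?thesis by (rule minus_equality) (simp_all add: R_zero)
qed

lemma y_powers_eq: "y_powers = {rr (fps_X ^ n) 0 | n. True}"
proof -
  have "R_y [^]\<^bsub>R_ring\<^esub> n = (rr (fps_X ^ n) 0 :: 'a rxy)" for n :: nat
    by (induction n) (simp_all add: R_one R_y_eq mult.commute)
  then show ?thesis by (simp add: y_powers_def)
qed

text \<open>The element \<open>c + d x\<close> of \<open>Q\<close>, as the set of all fractions \<open>(a + b x)/y\<^sup>n\<close> representing it.\<close>

definition qq :: "'k::field fls \<Rightarrow> 'k fls \<Rightarrow> 'k qxy" where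
  "qq c d = {(rr a b, rr (fps_X ^ n) 0) | a b n.
     fps_to_fls a = c * fls_X ^ n \<and> fps_to_fls b = d * fls_X ^ n}"


section \<open>Elements of \<open>Q\<close> as pairs of Laurent series in \<open>y\<close>\<close>

lemma ex_fls_numerator:
  fixes c :: "'k::field fls"
  shows "\<exists>a n. fps_to_fls a = c * fls_X ^ n"
proof -
  \<comment> \<open>The order of the pole of \<open>c\<close>; \<open>nat\<close> truncates it to 0
    when there is no pole.\<close>
  define n where "n = nat (- fls_subdegree c)"
  have "fls_subdegree (c * fls_X ^ n) \<ge> 0 \<or> c = 0"
    by (cases "c = 0") (auto simp: n_def fls_subdegree_mult_fls_X_power)
  then have "fps_to_fls (fls_regpart (c * fls_X ^ n)) = c * fls_X ^ n"
    by (auto intro: fls_regpart_to_fls_trivial)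
  then show ?thesis by blast
qed

lemma ex_fls_common_numerator:
  fixes c d :: "'k::field fls"
  shows "\<exists>a b n. fps_to_fls a = c * fls_X ^ n \<and> fps_to_fls b = d * fls_X ^ n"
proof -
  obtain a n where a: "fps_to_fls a = c * fls_X ^ n" using ex_fls_numerator by blast
  obtain b m where b: "fps_to_fls b = d * fls_X ^ m" using ex_fls_numerator by blast
  have "fps_to_fls (a * fps_X ^ m) = c * fls_X ^ (n + m)"
    using a by (simp add: fls_times_fps_to_fls fps_to_fls_power power_add mult_ac)
  moreover have "fps_to_fls (b * fps_X ^ n) = d * fls_X ^ (n + m)"
    using b by (simp add: fls_times_fps_to_fls fps_to_fls_power power_add mult_ac)
  ultimately show ?thesis by blast
qed

text \<open>What the product and sum rules for fractions demand of a set of denominators.\<close>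

lemma y_powers_closed:
  "y_powers \<subseteq> carrier R_ring" "\<one>\<^bsub>R_ring\<^esub> \<in> y_powers"
  "s \<in> y_powers \<Longrightarrow> t \<in> y_powers \<Longrightarrow> s \<otimes>\<^bsub>R_ring\<^esub> t \<in> y_powers"
  by (auto simp: y_powers_eq R_one intro: exI[of _ 0] simp flip: power_add)

lemma y_power_mem [simp]: "rr (fps_X ^ n) 0 \<in> y_powers"
  by (auto simp: y_powers_eq)

text \<open>Bridge from equivalence classes of fractions to pairs of Laurent series; all later
  arithmetic in \<open>Q\<close> rests on it.\<close>

lemma loc_frac_rr:
  "loc_frac R_ring y_powers (rr a b) (rr (fps_X ^ n) 0) =
     qq (fps_to_fls a / fls_X ^ n) (fps_to_fls b / fls_X ^ n)"
proof -
  \<comment> \<open>\<open>l\<close> is the exponent of the auxiliary factor in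
    \<open>frac_rel\<close>. Powers of \<open>y\<close> cancel in \<open>k[[y]]\<close>, so this
    factor disappears and cross multiplication can be read in the field
    \<open>k((y))\<close>.\<close>
  have *: "(\<exists>l. fps_X ^ l * (a * fps_X ^ m) = fps_X ^ l * (a' * fps_X ^ n) \<and>
      fps_X ^ l * (b * fps_X ^ m) = fps_X ^ l * (b' * fps_X ^ n)) \<longleftrightarrow>
      fps_to_fls a' = fps_to_fls a / fls_X ^ n * fls_X ^ m \<and>
      fps_to_fls b' = fps_to_fls b / fls_X ^ n * fls_X ^ m" for a' b' :: "'a fps" and m
  proof -
    have cancel: "fps_X ^ l * p = fps_X ^ l * q \<longleftrightarrow> p = q" for l and p q :: "'a fps" by simp
    have "u * fps_X ^ m = v * fps_X ^ n \<longleftrightarrow> fps_to_fls v = fps_to_fls u / fls_X ^ n * fls_X ^ m"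
      for u v :: "'a fps"
    proof -
      have "u * fps_X ^ m = v * fps_X ^ n \<longleftrightarrow>
          fps_to_fls u * fls_X ^ m = fps_to_fls v * fls_X ^ n"
        by (simp flip: fls_times_fps_to_fls fps_X_to_fls fps_to_fls_power)
      then show ?thesis by (auto simp: field_simps)
    qed
    then show ?thesis by (simp only: cancel) simp
  qed
  have "frac_rel R_ring y_powers `` {(rr a b, rr (fps_X ^ n) 0)} =
      {(rr a' b', rr (fps_X ^ m) 0) | a' b' m.
        \<exists>l. fps_X ^ l * (a * fps_X ^ m) = fps_X ^ l * (a' * fps_X ^ n) \<and>
          fps_X ^ l * (b * fps_X ^ m) = fps_X ^ l * (b' * fps_X ^ n)}"
    by (auto simp: frac_rel_def y_powers_eq R_carrier)
  then show ?thesis by (simp only: loc_frac_def qq_def *)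
qed

lemma qq_cases:
  obtains a b n where "c = fps_to_fls a / fls_X ^ n" "d = fps_to_fls b / fls_X ^ n"
    "qq c d = loc_frac R_ring y_powers (rr a b) (rr (fps_X ^ n) 0)"
proof -
  obtain a b n where "fps_to_fls a = c * fls_X ^ n" "fps_to_fls b = d * fls_X ^ n"
    using ex_fls_common_numerator by blast
  then have "c = fps_to_fls a / fls_X ^ n" "d = fps_to_fls b / fls_X ^ n" by (simp_all add: field_simps)
  with that show thesis by (simp add: loc_frac_rr)
qed

lemma qq_eq_iff [simp]: "qq c d = qq c' d' \<longleftrightarrow> c = c' \<and> d = d'"
proof
  assume eq: "qq c d = qq c' d'"
  obtain a b n where *: "fps_to_fls a = c * fls_X ^ n" "fps_to_fls b = d * fls_X ^ n"
    using ex_fls_common_numerator by blast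
  \<comment> \<open>One fraction common to both classes fixes both coordinates, since its
    denominator can be divided out in \<open>k((y))\<close>.\<close>
  then have "(rr a b, rr (fps_X ^ n) 0) \<in> qq c' d'" unfolding eq[symmetric] by (auto simp: qq_def)
  then show "c = c' \<and> d = d'" using * by (auto simp: qq_def)
qed simp

lemma Q_carrier: "carrier Q_ring = {qq c d | c d. True}"
proof -
  have "carrier Q_ring = {loc_frac R_ring y_powers (rr a b) (rr (fps_X ^ n) 0) :: 'a qxy | a b n. True}"
    by (auto simp: Q_ring_def localization_def quotient_def loc_frac_def R_carrier y_powers_eq)
  also have "\<dots> = {qq c d | c d. True}"
  proof (intro equalityI subsetI)
    fix z :: "'a qxy" assume "z \<in> {qq c d | c d. True}"
    then obtain c d where "z = qq c d" by blast
    moreover obtain a b n where "qq c d = loc_frac R_ring y_powers (rr a b) (rr (fps_X ^ n) 0)"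
      by (rule qq_cases)
    ultimately show "z \<in> {loc_frac R_ring y_powers (rr a b) (rr (fps_X ^ n) 0) | a b n. True}"
      by blast
  qed (use loc_frac_rr in blast)
  finally show ?thesis .
qed

lemma qq_mult [simp]: "qq c d \<otimes>\<^bsub>Q_ring\<^esub> qq c' d' = qq (c * c') (c * d' + d * c')"
proof -
  obtain a b n where 1: "c = fps_to_fls a / fls_X ^ n" "d = fps_to_fls b / fls_X ^ n"
    "qq c d = loc_frac R_ring y_powers (rr a b) (rr (fps_X ^ n) 0)" by (rule qq_cases)
  obtain a' b' m where 2: "c' = fps_to_fls a' / fls_X ^ m" "d' = fps_to_fls b' / fls_X ^ m"
    "qq c' d' = loc_frac R_ring y_powers (rr a' b') (rr (fps_X ^ m) 0)" by (rule qq_cases)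
  show ?thesis
    unfolding 1(3) 2(3) Q_ring_def
    by (subst loc_frac_mult[OF R_ring_cring y_powers_closed])
       (simp_all add: 1(1,2) 2(1,2) loc_frac_rr fls_times_fps_to_fls add_divide_distrib flip: power_add)
qed

lemma qq_add [simp]: "qq c d \<oplus>\<^bsub>Q_ring\<^esub> qq c' d' = qq (c + c') (d + d')"
proof -
  obtain a b n where 1: "c = fps_to_fls a / fls_X ^ n" "d = fps_to_fls b / fls_X ^ n"
    "qq c d = loc_frac R_ring y_powers (rr a b) (rr (fps_X ^ n) 0)" by (rule qq_cases)
  obtain a' b' m where 2: "c' = fps_to_fls a' / fls_X ^ m" "d' = fps_to_fls b' / fls_X ^ m"
    "qq c' d' = loc_frac R_ring y_powers (rr a' b') (rr (fps_X ^ m) 0)" by (rule qq_cases)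
  have *: "(u * fls_X ^ m + v * fls_X ^ n) / fls_X ^ (n + m) = u / fls_X ^ n + v / fls_X ^ m"
    for u v :: "'a fls" by (simp add: power_add field_simps)
  show ?thesis
    unfolding 1(3) 2(3) Q_ring_def
    by (subst loc_frac_add[OF R_ring_cring y_powers_closed])
       (simp_all add: loc_frac_rr fls_times_fps_to_fls fps_to_fls_power 1(1,2) 2(1,2) * flip: power_add)
qed

lemma Q_zero: "\<zero>\<^bsub>Q_ring\<^esub> = qq 0 0"
  using loc_frac_rr[of 0 0 0] by (simp add: Q_ring_def localization_def R_zero R_one)

lemma R_to_Q_rr: "R_to_Q (rr a b) = qq (fps_to_fls a) (fps_to_fls b)"
  using loc_frac_rr[of a b 0] by (simp add: R_to_Q_def R_one)

section \<open>The \<open>R\<close>-modules \<open>Q\<close>, \<open>R_tilde\<close> and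
  \<open>I_infty\<close> in coordinates\<close>

lemma Q_module_simps [simp]:
  "\<zero>\<^bsub>Q_module\<^esub> = qq 0 0"
  "qq c d \<oplus>\<^bsub>Q_module\<^esub> qq c' d' = qq (c + c') (d + d')"
  "rr a b \<odot>\<^bsub>Q_module\<^esub> qq c d = qq (fps_to_fls a * c) (fps_to_fls a * d + fps_to_fls b * c)"
  by (simp_all add: Q_module_def module_via_def Q_zero R_to_Q_rr)

text \<open>The \<open>x\<close>-part of an element of \<open>R\<close> is absorbed by
  \<open>xQ\<close>, whose \<open>x\<close>-coefficients already fill \<open>k((y))\<close>; only
  the other coordinate stays a power series.\<close>

lemma R_tilde_carrier: "carrier R_tilde = {qq (fps_to_fls a) d | a d. True}"
proof -
  have "carrier R_tilde = {qq (fps_to_fls a) (fps_to_fls b) \<oplus>\<^bsub>Q_ring\<^esub>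
      (qq 0 1 \<otimes>\<^bsub>Q_ring\<^esub> qq c d) :: 'a qxy | a b c d. True}"
    by (simp add: R_tilde_def R_carrier Q_carrier R_x_eq l_coset_def set_add_def' R_to_Q_rr)
      (fastforce simp: R_to_Q_rr)
  also have "\<dots> = {qq (fps_to_fls a) d | a d. True}"
  proof (intro equalityI subsetI)
    fix z :: "'a qxy" assume "z \<in> {qq (fps_to_fls a) d | a d. True}"
    then obtain a d where "z = qq (fps_to_fls a) d" by blast
    then have "z = qq (fps_to_fls a) (fps_to_fls 0) \<oplus>\<^bsub>Q_ring\<^esub> (qq 0 1 \<otimes>\<^bsub>Q_ring\<^esub> qq d 0)" by simp
    then show "z \<in> {qq (fps_to_fls a) (fps_to_fls b) \<oplus>\<^bsub>Q_ring\<^esub>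
      (qq 0 1 \<otimes>\<^bsub>Q_ring\<^esub> qq c d) | a b c d. True}" by blast
  qed auto
  finally show ?thesis .
qed

lemma I_infty_carrier: "carrier I_infty = {qq 0 (fps_to_fls d) | d. True}"
proof -
  have "carrier I_infty = {qq 0 1 \<otimes>\<^bsub>Q_ring\<^esub> qq (fps_to_fls a) (fps_to_fls b) :: 'a qxy | a b. True}"
    by (simp add: I_infty_def R_carrier R_x_eq l_coset_def R_to_Q_rr) (fastforce simp: R_to_Q_rr)
  then show ?thesis by simp
qed

section \<open>Extension of semilinear maps into a field\<close>

text \<open>Lets an \<open>R\<close>-module be treated as a vector space over \<open>k\<close> and
  as a module over \<open>k[[y]]\<close>, along the inclusions of these rings into
  \<open>R\<close>.\<close>

definition restrict_scalars :: "('a \<Rightarrow> 'r) \<Rightarrow> ('r, 'm) module \<Rightarrow> ('a, 'm) module" where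
  "restrict_scalars s M =
    \<lparr>carrier = carrier M, monoid.mult = monoid.mult M, one = monoid.one M,
     ring.zero = ring.zero M, add = ring.add M, module.smult = (\<lambda>a m. s a \<odot>\<^bsub>M\<^esub> m)\<rparr>"

lemma restrict_scalars_simps [simp]:
  "carrier (restrict_scalars s M) = carrier M"
  "\<zero>\<^bsub>restrict_scalars s M\<^esub> = \<zero>\<^bsub>M\<^esub>"
  "m \<oplus>\<^bsub>restrict_scalars s M\<^esub> m' = m \<oplus>\<^bsub>M\<^esub> m'"
  "a \<odot>\<^bsub>restrict_scalars s M\<^esub> m = s a \<odot>\<^bsub>M\<^esub> m"
  by (simp_all add: restrict_scalars_def)

lemma module_restrict_scalars:
  assumes "module R M" and s: "s \<in> ring_hom S R" and "cring S"
  shows "module S (restrict_scalars s M)"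
proof -
  interpret module R M by fact
  show ?thesis
  proof (rule moduleI)
    show "abelian_group (restrict_scalars s M)"
    proof (rule abelian_groupI)
      fix m assume "m \<in> carrier (restrict_scalars s M)"
      then show "\<exists>m' \<in> carrier (restrict_scalars s M).
          m' \<oplus>\<^bsub>restrict_scalars s M\<^esub> m = \<zero>\<^bsub>restrict_scalars s M\<^esub>"
        by (auto intro!: bexI[of _ "\<ominus>\<^bsub>M\<^esub> m"] simp: M.l_neg)
    qed (auto simp: M.a_ac)
  qed (use \<open>cring S\<close> ring_hom_closed[OF s] in
      \<open>auto simp: ring_hom_add[OF s] ring_hom_mult[OF s] ring_hom_one[OF s]
        smult_l_distr smult_r_distr smult_assoc1\<close>)
qed

text \<open>\<open>e\<close> carries the scalars into the ring of values. Three cases occur: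
  \<open>id\<close> on \<open>k\<close> for functionals, \<open>id\<close> on \<open>k[[y]]\<close>
  for power series valued maps, and \<open>fps_to_fls\<close> for maps into
  \<open>k((y))\<close>.\<close>

definition semilinear :: "('a \<Rightarrow> 'b) \<Rightarrow> ('a, 'm) module \<Rightarrow> ('m \<Rightarrow> 'b::semiring_1) \<Rightarrow> bool" where
  "semilinear e M f \<longleftrightarrow>
     (\<forall>m \<in> carrier M. \<forall>m' \<in> carrier M. f (m \<oplus>\<^bsub>M\<^esub> m') = f m + f m') \<and>
     (\<forall>a. \<forall>m \<in> carrier M. f (a \<odot>\<^bsub>M\<^esub> m) = e a * f m)"

text \<open>For a set closed under addition and scalars, the last clause says that it is single-valued.\<close>

definition semilinear_graph :: "('a \<Rightarrow> 'b) \<Rightarrow> ('a, 'm) module \<Rightarrow> ('m \<times> 'b::semiring_1) set \<Rightarrow> bool" where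
  "semilinear_graph e M G \<longleftrightarrow>
     G \<noteq> {} \<and> (\<forall>m b. (m, b) \<in> G \<longrightarrow> m \<in> carrier M) \<and>
     (\<forall>m b m' b'. (m, b) \<in> G \<longrightarrow> (m', b') \<in> G \<longrightarrow> (m \<oplus>\<^bsub>M\<^esub> m', b + b') \<in> G) \<and>
     (\<forall>a m b. (m, b) \<in> G \<longrightarrow> (a \<odot>\<^bsub>M\<^esub> m, e a * b) \<in> G) \<and>
     (\<forall>b. (\<zero>\<^bsub>M\<^esub>, b) \<in> G \<longrightarrow> b = 0)"

lemma semilinear_graph_Union:
  assumes "subset.chain {G. semilinear_graph e M G} C" "C \<noteq> {}"
  shows "semilinear_graph e M (\<Union>C)"
proof -
  have C: "semilinear_graph e M G" if "G \<in> C" for G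
    using assms that by (auto simp: subset.chain_def)
  have tot: "G \<subseteq> H \<or> H \<subseteq> G" if "G \<in> C" "H \<in> C" for G H
    using assms that by (auto simp: subset.chain_def)
  show ?thesis
    unfolding semilinear_graph_def
  proof (intro conjI allI impI)
    show "\<Union>C \<noteq> {}" using assms(2) C by (fastforce simp: semilinear_graph_def)
    show "m \<in> carrier M" if "(m, b) \<in> \<Union>C" for m b
      using that C by (fastforce simp: semilinear_graph_def)
    show "(a \<odot>\<^bsub>M\<^esub> m, e a * b) \<in> \<Union>C" if "(m, b) \<in> \<Union>C" for a m b
      using that C by (fastforce simp: semilinear_graph_def)
    show "b = 0" if "(\<zero>\<^bsub>M\<^esub>, b) \<in> \<Union>C" for b
      using that C by (fastforce simp: semilinear_graph_def)
    fix m b m' b' assume "(m, b) \<in> \<Union>C" "(m', b') \<in> \<Union>C"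
    then obtain G H where "G \<in> C" "H \<in> C" "(m, b) \<in> G" "(m', b') \<in> H" by blast
    \<comment> \<open>Addition is the one clause that involves two pairs; comparability of
      \<open>G\<close> and \<open>H\<close> puts both in a single member of the chain.\<close>
    with tot[of G H] obtain K where "K \<in> C" "(m, b) \<in> K" "(m', b') \<in> K" by blast
    then show "(m \<oplus>\<^bsub>M\<^esub> m', b + b') \<in> \<Union>C" using C[of K] unfolding semilinear_graph_def by blast
  qed
qed

section \<open>Extension along an injective scalar map into a field\<close>

context
  fixes M :: "('a::comm_ring_1, 'm) module" and e :: "'a \<Rightarrow> 'b::field"
  assumes M: "module ring_of_type_algebra M"
    and e_add: "\<And>a b. e (a + b) = e a + e b" and e_mult: "\<And>a b. e (a * b) = e a * e b"
    and e_one: "e 1 = 1" and e_inj: "\<And>a. e a = 0 \<Longrightarrow> a = 0"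
begin

interpretation M: module "ring_of_type_algebra :: 'a ring" M by (rule M)

lemma scalar_hom_zero: "e 0 = 0"
  using e_add[of 0 0] by (metis add.right_neutral add_left_cancel)

lemma scalar_hom_minus: "e (- a) = - e a"
  using e_add[of a "- a"] by (simp add: scalar_hom_zero eq_neg_iff_add_eq_0 add.commute)

lemma type_algebra_smult:
  assumes "m \<in> carrier M"
  shows "a \<odot>\<^bsub>M\<^esub> m \<in> carrier M" "(a + b) \<odot>\<^bsub>M\<^esub> m = a \<odot>\<^bsub>M\<^esub> m \<oplus>\<^bsub>M\<^esub> b \<odot>\<^bsub>M\<^esub> m"
    "(a * b) \<odot>\<^bsub>M\<^esub> m = a \<odot>\<^bsub>M\<^esub> (b \<odot>\<^bsub>M\<^esub> m)" "1 \<odot>\<^bsub>M\<^esub> m = m" "0 \<odot>\<^bsub>M\<^esub> m = \<zero>\<^bsub>M\<^esub>"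
    "m' \<in> carrier M \<Longrightarrow> a \<odot>\<^bsub>M\<^esub> (m \<oplus>\<^bsub>M\<^esub> m') = a \<odot>\<^bsub>M\<^esub> m \<oplus>\<^bsub>M\<^esub> a \<odot>\<^bsub>M\<^esub> m'"
    "(- 1) \<odot>\<^bsub>M\<^esub> m = \<ominus>\<^bsub>M\<^esub> m"
proof -
  note * = M.smult_closed[of a m] M.smult_l_distr[of a b m] M.smult_assoc1[of a b m]
    M.smult_one[of m] M.smult_l_null[of m] M.smult_r_distr[of a m m']
  note * = *[unfolded ring_of_type_algebra_def, simplified]
  show "a \<odot>\<^bsub>M\<^esub> m \<in> carrier M" "(a + b) \<odot>\<^bsub>M\<^esub> m = a \<odot>\<^bsub>M\<^esub> m \<oplus>\<^bsub>M\<^esub> b \<odot>\<^bsub>M\<^esub> m"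
    "(a * b) \<odot>\<^bsub>M\<^esub> m = a \<odot>\<^bsub>M\<^esub> (b \<odot>\<^bsub>M\<^esub> m)" "1 \<odot>\<^bsub>M\<^esub> m = m" "0 \<odot>\<^bsub>M\<^esub> m = \<zero>\<^bsub>M\<^esub>"
    "m' \<in> carrier M \<Longrightarrow> a \<odot>\<^bsub>M\<^esub> (m \<oplus>\<^bsub>M\<^esub> m') = a \<odot>\<^bsub>M\<^esub> m \<oplus>\<^bsub>M\<^esub> a \<odot>\<^bsub>M\<^esub> m'"
    using * assms by auto
  have "(- 1) \<odot>\<^bsub>M\<^esub> m \<oplus>\<^bsub>M\<^esub> m = (- 1 + 1) \<odot>\<^bsub>M\<^esub> m"
    using assms M.smult_l_distr[of "-1" 1 m] M.smult_one[of m] by (simp add: ring_of_type_algebra_def)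
  also have "\<dots> = \<zero>\<^bsub>M\<^esub>" using M.smult_l_null[of m] assms by (simp add: ring_of_type_algebra_def)
  finally show "(- 1) \<odot>\<^bsub>M\<^esub> m = \<ominus>\<^bsub>M\<^esub> m"
    using assms M.smult_closed[of "-1" m] by (intro M.minus_equality[symmetric]) (auto simp: ring_of_type_algebra_def)
qed

text \<open>Subtracting the two pairs puts \<open>b - b'\<close> over zero, where only 0 is
  allowed.\<close>

lemma semilinear_graph_unique:
  assumes G: "semilinear_graph e M G" and "(m, b) \<in> G" "(m, b') \<in> G"
  shows "b = b'"
proof -
  have m: "m \<in> carrier M" using assms unfolding semilinear_graph_def by blast
  have "((- 1) \<odot>\<^bsub>M\<^esub> m, e (- 1) * b') \<in> G" using assms unfolding semilinear_graph_def by blast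
  then have "(m \<oplus>\<^bsub>M\<^esub> (- 1) \<odot>\<^bsub>M\<^esub> m, b + e (- 1) * b') \<in> G"
    using assms unfolding semilinear_graph_def by blast
  then have "(\<zero>\<^bsub>M\<^esub>, b - b') \<in> G" using m by (simp add: type_algebra_smult scalar_hom_minus e_one M.r_neg)
  then show ?thesis using G by (auto simp: semilinear_graph_def)
qed

text \<open>The one-element step of Baer's criterion: a value \<open>d\<close> at \<open>n\<close>
  is admissible as soon as it agrees with \<open>G\<close> on every multiple of \<open>n\<close> in
  the domain of \<open>G\<close>.\<close>

lemma semilinear_graph_step:
  assumes G: "semilinear_graph e M G" and n: "n \<in> carrier M"
  obtains H d where "semilinear_graph e M H" "G \<subseteq> H" "(n, d) \<in> H"
proof -
  note GD = G[unfolded semilinear_graph_def]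
  obtain d where d: "b = e a * d" if "(a \<odot>\<^bsub>M\<^esub> n, b) \<in> G" for a b
  \<comment> \<open>One nonzero multiple \<open>a\<close> of \<open>n\<close> in the domain
    determines \<open>d\<close> as \<open>b / e a\<close>, and comparing values at
    \<open>a a' n\<close> shows that every other multiple agrees. If only the zero multiple lies
    there, any value works and 0 is taken.\<close>
  proof (cases "\<exists>a b. a \<noteq> 0 \<and> (a \<odot>\<^bsub>M\<^esub> n, b) \<in> G")
    case True
    then obtain a b where ab: "a \<noteq> 0" "(a \<odot>\<^bsub>M\<^esub> n, b) \<in> G" by blast
    show ?thesis
    proof (rule that)
      fix a' b' assume "(a' \<odot>\<^bsub>M\<^esub> n, b') \<in> G"
      then have "(a \<odot>\<^bsub>M\<^esub> (a' \<odot>\<^bsub>M\<^esub> n), e a * b') \<in> G" "(a' \<odot>\<^bsub>M\<^esub> (a \<odot>\<^bsub>M\<^esub> n), e a' * b) \<in> G"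
        using ab GD by blast+
      moreover have "a \<odot>\<^bsub>M\<^esub> (a' \<odot>\<^bsub>M\<^esub> n) = a' \<odot>\<^bsub>M\<^esub> (a \<odot>\<^bsub>M\<^esub> n)"
        using n by (simp flip: type_algebra_smult(3) add: mult.commute)
      ultimately have "e a * b' = e a' * b" using semilinear_graph_unique[OF G] by metis
      moreover have "e a \<noteq> 0" using ab(1) e_inj by blast
      ultimately show "b' = e a' * (b / e a)" by (simp add: field_simps)
    qed
  next
    case False
    show ?thesis
    proof (rule that)
      fix a b assume *: "(a \<odot>\<^bsub>M\<^esub> n, b) \<in> G"
      then have "a = 0" using False by blast
      then show "b = e a * 0" using * GD n by (simp add: type_algebra_smult)
    qed
  qed
  define H where "H = {(m \<oplus>\<^bsub>M\<^esub> a \<odot>\<^bsub>M\<^esub> n, b + e a * d) | m b a. (m, b) \<in> G}"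
  have GM: "m \<in> carrier M" if "(m, b) \<in> G" for m b using that GD by blast
  have G0: "(\<zero>\<^bsub>M\<^esub>, 0) \<in> G"
  proof -
    obtain m b where "(m, b) \<in> G" using GD by (metis surj_pair all_not_in_conv)
    then have "(0 \<odot>\<^bsub>M\<^esub> m, e 0 * b) \<in> G" "m \<in> carrier M" using GD GM by blast+
    then show ?thesis by (simp add: type_algebra_smult scalar_hom_zero)
  qed
  have "semilinear_graph e M H"
    unfolding semilinear_graph_def
  proof (intro conjI allI impI)
    show "H \<noteq> {}" using G0 unfolding H_def by blast
    show "m \<in> carrier M" if "(m, b) \<in> H" for m b
      using that GM n by (auto simp: H_def type_algebra_smult)
    show "(c \<odot>\<^bsub>M\<^esub> m, e c * b) \<in> H" if mb: "(m, b) \<in> H" for c m b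
    proof -
      obtain m' b' a where *: "m = m' \<oplus>\<^bsub>M\<^esub> a \<odot>\<^bsub>M\<^esub> n" "b = b' + e a * d" "(m', b') \<in> G"
        using mb by (auto simp: H_def)
      have "c \<odot>\<^bsub>M\<^esub> m = c \<odot>\<^bsub>M\<^esub> m' \<oplus>\<^bsub>M\<^esub> (c * a) \<odot>\<^bsub>M\<^esub> n" "e c * b = e c * b' + e (c * a) * d"
        using * n GM by (auto simp: type_algebra_smult e_mult distrib_left mult.assoc)
      moreover have "(c \<odot>\<^bsub>M\<^esub> m', e c * b') \<in> G" using *(3) GD by blast
      ultimately show ?thesis unfolding H_def by blast
    qed
    show "(m1 \<oplus>\<^bsub>M\<^esub> m2, b1 + b2) \<in> H" if mb: "(m1, b1) \<in> H" "(m2, b2) \<in> H" for m1 b1 m2 b2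
    proof -
      obtain m1' b1' a1 m2' b2' a2 where *: "m1 = m1' \<oplus>\<^bsub>M\<^esub> a1 \<odot>\<^bsub>M\<^esub> n" "b1 = b1' + e a1 * d" "(m1', b1') \<in> G"
        "m2 = m2' \<oplus>\<^bsub>M\<^esub> a2 \<odot>\<^bsub>M\<^esub> n" "b2 = b2' + e a2 * d" "(m2', b2') \<in> G"
        using mb by (auto simp: H_def)
      have "m1 \<oplus>\<^bsub>M\<^esub> m2 = (m1' \<oplus>\<^bsub>M\<^esub> m2') \<oplus>\<^bsub>M\<^esub> (a1 + a2) \<odot>\<^bsub>M\<^esub> n"
        using *(1,4) GM[OF *(3)] GM[OF *(6)] n by (simp add: type_algebra_smult M.a_ac)
      moreover have "b1 + b2 = (b1' + b2') + e (a1 + a2) * d"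
        using * by (simp add: e_add algebra_simps)
      moreover have "(m1' \<oplus>\<^bsub>M\<^esub> m2', b1' + b2') \<in> G" using *(3,6) GD by blast
      ultimately show ?thesis unfolding H_def by blast
    qed
    show "b = 0" if mb: "(\<zero>\<^bsub>M\<^esub>, b) \<in> H" for b
    proof -
      obtain m b' a where *: "m \<oplus>\<^bsub>M\<^esub> a \<odot>\<^bsub>M\<^esub> n = \<zero>\<^bsub>M\<^esub>" "b = b' + e a * d" "(m, b') \<in> G"
        using mb by (auto simp: H_def)
      have "m = \<ominus>\<^bsub>M\<^esub> (a \<odot>\<^bsub>M\<^esub> n)"
        using *(1) GM[OF *(3)] n by (metis M.minus_equality type_algebra_smult(1))
      \<comment> \<open>This multiple of \<open>n\<close> lies in the domain of \<open>G\<close>, so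
        the choice of \<open>d\<close> identifies \<open>- b'\<close> with \<open>e a * d\<close>,
        and the two parts of \<open>b\<close> cancel.\<close>
      then have "(- 1) \<odot>\<^bsub>M\<^esub> m = a \<odot>\<^bsub>M\<^esub> n"
        using n by (simp add: type_algebra_smult)
      moreover have "((- 1) \<odot>\<^bsub>M\<^esub> m, e (- 1) * b') \<in> G" using *(3) GD by blast
      ultimately have eq: "e (- 1) * b' = e a * d" using d by metis
      then show ?thesis using *(2) by (simp add: scalar_hom_minus e_one flip: eq)
    qed
  qed
  moreover have "G \<subseteq> H"
  proof
    fix p assume p: "p \<in> G"
    obtain m b where mb: "p = (m, b)" by fastforce
    then have "(m \<oplus>\<^bsub>M\<^esub> 0 \<odot>\<^bsub>M\<^esub> n, b + e 0 * d) \<in> H" using p unfolding H_def by blast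
    then show "p \<in> H" using p mb GM n by (simp add: type_algebra_smult scalar_hom_zero)
  qed
  moreover have "(n, d) \<in> H"
  proof -
    have "(\<zero>\<^bsub>M\<^esub> \<oplus>\<^bsub>M\<^esub> 1 \<odot>\<^bsub>M\<^esub> n, 0 + e 1 * d) \<in> H" using G0 unfolding H_def by blast
    then show ?thesis using n by (simp add: type_algebra_smult e_one)
  qed
  ultimately show thesis by (rule that)
qed

text \<open>By Zorn's lemma there is a maximal graph above \<open>G\<close>; it is defined
  everywhere because \<open>semilinear_graph_step\<close> would otherwise enlarge it. Over
  \<open>k\<close> this extends linear functionals, and with values in \<open>k((y))\<close> it is
  the injectivity of \<open>k((y))\<close> over \<open>k[[y]]\<close>.\<close>

lemma semilinear_extend:
  assumes G: "semilinear_graph e M G"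
  obtains f where "semilinear e M f" "\<And>m b. (m, b) \<in> G \<Longrightarrow> f m = b"
proof -
  define A where "A = {H. semilinear_graph e M H \<and> G \<subseteq> H}"
  have "\<exists>H \<in> A. \<forall>K \<in> A. H \<subseteq> K \<longrightarrow> K = H"
  proof (rule subset_Zorn_nonempty)
    show "A \<noteq> {}" using G by (auto simp: A_def)
    fix C assume C: "C \<noteq> {}" "subset.chain A C"
    then have "semilinear_graph e M (\<Union>C)"
      by (intro semilinear_graph_Union) (auto simp: subset.chain_def A_def)
    moreover have "G \<subseteq> \<Union>C"
      using C subset.chain_def[of A C] unfolding A_def by blast
    ultimately show "\<Union>C \<in> A" by (simp add: A_def)
  qed
  then obtain H where HA: "H \<in> A" and H_max: "\<And>K. K \<in> A \<Longrightarrow> H \<subseteq> K \<Longrightarrow> K = H" by metis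
  have H: "semilinear_graph e M H" "G \<subseteq> H" using HA by (simp_all add: A_def)
  note HD = H(1)[unfolded semilinear_graph_def]
  define f where "f m = (THE b. (m, b) \<in> H)" for m
  have f_eq: "f m = b" if "(m, b) \<in> H" for m b
    using that semilinear_graph_unique[OF H(1)] by (auto simp: f_def)
  have f: "(m, f m) \<in> H" if m: "m \<in> carrier M" for m
  proof -
    obtain K d where K: "semilinear_graph e M K" "H \<subseteq> K" "(m, d) \<in> K"
      by (rule semilinear_graph_step[OF H(1) m])
    then have "K = H" using H(2) by (intro H_max) (auto simp: A_def)
    then have "(m, d) \<in> H" using K(3) by simp
    then show ?thesis using f_eq by auto
  qed
  show thesis
  proof
    show "semilinear e M f"
      unfolding semilinear_def
    proof (intro conjI ballI allI)
      fix m m' assume "m \<in> carrier M" "m' \<in> carrier M"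
      then have "(m \<oplus>\<^bsub>M\<^esub> m', f m + f m') \<in> H" using f HD by blast
      then show "f (m \<oplus>\<^bsub>M\<^esub> m') = f m + f m'" by (rule f_eq)
    next
      fix a m assume "m \<in> carrier M"
      then have "(m, f m) \<in> H" by (rule f)
      then have "(a \<odot>\<^bsub>M\<^esub> m, e a * f m) \<in> H" using HD by simp
      then show "f (a \<odot>\<^bsub>M\<^esub> m) = e a * f m" by (rule f_eq)
    qed
    show "f m = b" if "(m, b) \<in> G" for m b using that H(2) f_eq by blast
  qed
qed

end

section \<open>Homomorphisms and endomorphism rings\<close>

lemma mod_homI:
  assumes "\<And>a. a \<in> carrier M \<Longrightarrow> h a \<in> carrier N"
    and "\<And>a b. a \<in> carrier M \<Longrightarrow> b \<in> carrier M \<Longrightarrow> h (a \<oplus>\<^bsub>M\<^esub> b) = h a \<oplus>\<^bsub>N\<^esub> h b"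
    and "\<And>r a. r \<in> carrier R \<Longrightarrow> a \<in> carrier M \<Longrightarrow> h (r \<odot>\<^bsub>M\<^esub> a) = r \<odot>\<^bsub>N\<^esub> h a"
    and "module R M"
  shows "(\<lambda>a \<in> carrier M. h a) \<in> mod_hom R M N"
proof -
  interpret module R M by fact
  show ?thesis using assms by (simp add: mod_hom_def)
qed

lemma mod_homD:
  assumes "h \<in> mod_hom R M N"
  shows "a \<in> carrier M \<Longrightarrow> h a \<in> carrier N"
    and "a \<in> carrier M \<Longrightarrow> b \<in> carrier M \<Longrightarrow> h (a \<oplus>\<^bsub>M\<^esub> b) = h a \<oplus>\<^bsub>N\<^esub> h b"
    and "r \<in> carrier R \<Longrightarrow> a \<in> carrier M \<Longrightarrow> h (r \<odot>\<^bsub>M\<^esub> a) = r \<odot>\<^bsub>N\<^esub> h a"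
    and "h \<in> extensional (carrier M)"
  using assms by (auto simp: mod_hom_def PiE_def)

lemma mod_hom_eqI:
  assumes "h \<in> mod_hom R M N" "h' \<in> mod_hom R M N'" "\<And>a. a \<in> carrier M \<Longrightarrow> h a = h' a"
  shows "h = h'"
  by (rule extensionalityI[OF mod_homD(4)[OF assms(1)] mod_homD(4)[OF assms(2)] assms(3)])

lemma mod_hom_compose:
  assumes "g \<in> mod_hom R N P" "f \<in> mod_hom R M N" "module R M"
  shows "compose (carrier M) g f \<in> mod_hom R M P"
  unfolding compose_def by (rule mod_homI) (use assms in \<open>auto simp: mod_homD\<close>)

lemma End_ring_ring:
  assumes "module R M"
  shows "ring (End_ring R M)"
proof -
  interpret module R M by fact
  have add: "(\<lambda>a \<in> carrier M. f a \<oplus>\<^bsub>M\<^esub> g a) \<in> mod_hom R M M"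
    if "f \<in> mod_hom R M M" "g \<in> mod_hom R M M" for f g
    by (rule mod_homI) (use that in \<open>auto simp: mod_homD smult_r_distr M.a_ac assms\<close>)
  have neg: "(\<lambda>a \<in> carrier M. \<ominus>\<^bsub>M\<^esub> f a) \<in> mod_hom R M M" if "f \<in> mod_hom R M M" for f
    by (rule mod_homI) (use that in \<open>auto simp: mod_homD smult_r_minus M.minus_add assms\<close>)
  have zero: "mod_zero M M \<in> mod_hom R M M"
    unfolding mod_zero_def by (rule mod_homI) (auto simp: assms)
  have one: "mod_id M \<in> mod_hom R M M"
    unfolding mod_id_def by (rule mod_homI) (auto simp: assms)
  note ext = extensionalityI[of _ "carrier M"]
  show ?thesis
  proof (rule ringI)
    show "abelian_group (End_ring R M)"
    proof (rule abelian_groupI)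
      fix f assume "f \<in> carrier (End_ring R M)"
      then have f: "f \<in> mod_hom R M M" by (simp add: End_ring_def)
      have "(\<lambda>a \<in> carrier M. (\<lambda>a \<in> carrier M. \<ominus>\<^bsub>M\<^esub> f a) a \<oplus>\<^bsub>M\<^esub> f a) = mod_zero M M"
        by (rule ext) (use f in \<open>auto simp: mod_zero_def mod_homD M.l_neg\<close>)
      then show "\<exists>g \<in> carrier (End_ring R M). g \<oplus>\<^bsub>End_ring R M\<^esub> f = \<zero>\<^bsub>End_ring R M\<^esub>"
        using neg[OF f] by (auto simp: End_ring_def intro!: bexI[of _ "\<lambda>a \<in> carrier M. \<ominus>\<^bsub>M\<^esub> f a"])
    qed (auto simp: End_ring_def add zero[unfolded mod_zero_def] mod_homD mod_zero_def M.a_ac intro!: ext)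
    show "monoid (End_ring R M)"
      by (rule monoidI) (auto simp: End_ring_def one[unfolded mod_id_def] mod_hom_compose[unfolded compose_def] assms mod_homD mod_id_def compose_def intro!: ext)
  qed (auto simp: End_ring_def mod_homD compose_def intro!: ext)
qed

text \<open>Since \<chi> maps 1 to 1 and is multiplicative, it is nonzero on units; with
  \<open>unit\<close> the non-units are exactly its kernel, which is an ideal.\<close>

lemma local_ringI_character:
  fixes \<chi> :: "'a \<Rightarrow> 'b::field"
  assumes "ring E"
    and add: "\<And>f g. f \<in> carrier E \<Longrightarrow> g \<in> carrier E \<Longrightarrow> \<chi> (f \<oplus>\<^bsub>E\<^esub> g) = \<chi> f + \<chi> g"
    and mult: "\<And>f g. f \<in> carrier E \<Longrightarrow> g \<in> carrier E \<Longrightarrow> \<chi> (f \<otimes>\<^bsub>E\<^esub> g) = \<chi> f * \<chi> g"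
    and one: "\<chi> \<one>\<^bsub>E\<^esub> = 1"
    and unit: "\<And>f. f \<in> carrier E \<Longrightarrow> \<chi> f \<noteq> 0 \<Longrightarrow> f \<in> Units E"
  shows "local_ring E"
proof -
  interpret ring E by fact
  have nonzero: "\<chi> f \<noteq> 0" if f: "f \<in> Units E" for f
  proof
    assume "\<chi> f = 0"
    moreover obtain g where "g \<in> carrier E" "f \<otimes>\<^bsub>E\<^esub> g = \<one>\<^bsub>E\<^esub>" using f by (auto simp: Units_def)
    ultimately show False using mult[of f g] one f by (simp add: Units_closed)
  qed
  then have eq: "carrier E - Units E = {f \<in> carrier E. \<chi> f = 0}" using unit by blast
  have zero: "\<chi> \<zero>\<^bsub>E\<^esub> = 0" using add[of "\<zero>\<^bsub>E\<^esub>" "\<zero>\<^bsub>E\<^esub>"] by (metis add_cancel_right_right l_zero zero_closed)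
  have minus: "\<chi> (\<ominus>\<^bsub>E\<^esub> f) = 0" if "f \<in> carrier E" "\<chi> f = 0" for f
    using add[of f "\<ominus>\<^bsub>E\<^esub> f"] that zero by (simp add: r_neg)
  have "ideal {f \<in> carrier E. \<chi> f = 0} E"
  proof (rule idealI[OF ring_axioms])
    show "subgroup {f \<in> carrier E. \<chi> f = 0} (add_monoid E)"
      by (rule add.subgroupI) (use zero add minus in auto)
  qed (use mult in auto)
  then show ?thesis using \<open>ring E\<close> by (simp add: local_ring_def eq)
qed

section \<open>Direct sums of CM-modules\<close>

lemma direct_sum_simps [simp]:
  "carrier (direct_sum M N) = carrier M \<times> carrier N"
  "(a, b) \<oplus>\<^bsub>direct_sum M N\<^esub> (c, d) = (a \<oplus>\<^bsub>M\<^esub> c, b \<oplus>\<^bsub>N\<^esub> d)"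
  "r \<odot>\<^bsub>direct_sum M N\<^esub> (a, b) = (r \<odot>\<^bsub>M\<^esub> a, r \<odot>\<^bsub>N\<^esub> b)"
  "\<zero>\<^bsub>direct_sum M N\<^esub> = (\<zero>\<^bsub>M\<^esub>, \<zero>\<^bsub>N\<^esub>)"
  by (simp_all add: direct_sum_def)

lemma direct_sum_module:
  assumes "module R M" "module R N"
  shows "module R (direct_sum M N)"
proof -
  interpret M: module R M by fact
  interpret N: module R N by fact
  show ?thesis
  proof (rule moduleI)
    show "abelian_group (direct_sum M N)"
    proof (rule abelian_groupI)
      fix p assume "p \<in> carrier (direct_sum M N)"
      then show "\<exists>q \<in> carrier (direct_sum M N). q \<oplus>\<^bsub>direct_sum M N\<^esub> p = \<zero>\<^bsub>direct_sum M N\<^esub>"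
        by (auto intro!: bexI[of _ "(\<ominus>\<^bsub>M\<^esub> fst p, \<ominus>\<^bsub>N\<^esub> snd p)"] simp: M.l_neg N.l_neg)
    qed (auto simp: M.M.a_ac N.M.a_ac)
  qed (auto simp: M.cring_axioms M.smult_l_distr M.smult_r_distr M.smult_assoc1
      N.smult_l_distr N.smult_r_distr N.smult_assoc1)
qed

lemma direct_sum_CM:
  assumes "CM_module M" "CM_module N"
  shows "CM_module (direct_sum M N)"
proof -
  have MN: "module R_ring M" "module R_ring N" using assms by (simp_all add: CM_module_def)
  show ?thesis
    using assms by (auto simp: CM_module_iff MN direct_sum_module)
qed

text \<open>The coordinates of \<open>c + d x\<close>, well defined by \<open>qq_eq_iff\<close>;
  they are meaningful only on elements of \<open>Q\<close>.\<close>

definition qfst :: "'k::field qxy \<Rightarrow> 'k fls" where "qfst z = (THE c. \<exists>d. z = qq c d)"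
definition qsnd :: "'k::field qxy \<Rightarrow> 'k fls" where "qsnd z = (THE d. \<exists>c. z = qq c d)"

lemma qfst_qq [simp]: "qfst (qq c d) = c" and qsnd_qq [simp]: "qsnd (qq c d) = d"
  by (auto simp: qfst_def qsnd_def)

text \<open>Multiplication by \<open>y\<close> is injective on \<open>Q\<close>, hence on each of
  its \<open>R\<close>-submodules. This covers \<open>R_tilde\<close> and \<open>I_infty\<close> at
  once.\<close>

lemma Q_submodule_CM:
  fixes C :: "'k::field qxy set"
  assumes C: "C \<subseteq> {qq c d | c d. True}" and zero: "qq 0 0 \<in> C"
    and add: "\<And>z w. z \<in> C \<Longrightarrow> w \<in> C \<Longrightarrow> z \<oplus>\<^bsub>Q_module\<^esub> w \<in> C"
    and smult: "\<And>a b z. z \<in> C \<Longrightarrow> rr a b \<odot>\<^bsub>Q_module\<^esub> z \<in> C"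
  shows "CM_module (Q_module\<lparr>carrier := C\<rparr>)"
proof -
  have cases: "\<exists>c d. z = qq c d" if "z \<in> C" for z using that C by blast
  have "module R_ring (Q_module\<lparr>carrier := C\<rparr>)"
  proof (rule moduleI[OF R_ring_cring])
    show "abelian_group (Q_module\<lparr>carrier := C\<rparr>)"
    proof (rule abelian_groupI)
      fix z assume "z \<in> carrier (Q_module\<lparr>carrier := C\<rparr>)"
      then have z: "z \<in> C" by simp
      obtain c d where "z = qq c d" using cases[OF z] by blast
      \<comment> \<open>The additive inverse is the multiple by -1, so closure under scalars
        supplies it.\<close>
      then show "\<exists>w \<in> carrier (Q_module\<lparr>carrier := C\<rparr>).
          w \<oplus>\<^bsub>Q_module\<lparr>carrier := C\<rparr>\<^esub> z = \<zero>\<^bsub>Q_module\<lparr>carrier := C\<rparr>\<^esub>"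
        using smult[OF z, of "- 1" 0] by (auto intro!: bexI[of _ "rr (- 1) 0 \<odot>\<^bsub>Q_module\<^esub> z"])
    qed (auto simp: zero add dest!: cases simp: add_ac)
    show "r \<odot>\<^bsub>Q_module\<lparr>carrier := C\<rparr>\<^esub> z \<in> carrier (Q_module\<lparr>carrier := C\<rparr>)"
      if "r \<in> carrier R_ring" "z \<in> carrier (Q_module\<lparr>carrier := C\<rparr>)" for r z
      using that smult by (auto simp: R_carrier)
  qed (auto simp: R_carrier R_one dest!: cases simp: fls_times_fps_to_fls algebra_simps)
  moreover have "z = qq 0 0" if z: "z \<in> C" "R_y \<odot>\<^bsub>Q_module\<^esub> z = qq 0 0" for z
  proof -
    obtain c d where "z = qq c d" using cases[OF z(1)] by blast
    then show ?thesis using z(2) by (simp add: R_y_eq)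
  qed
  ultimately show ?thesis by (simp add: CM_module_iff)
qed

lemma R_tilde_simps [simp]:
  "ring.add R_tilde = ring.add Q_module" "ring.zero R_tilde = ring.zero Q_module"
  "module.smult R_tilde = module.smult Q_module"
  by (simp_all add: R_tilde_def)

lemma I_infty_simps [simp]:
  "ring.add I_infty = ring.add Q_module" "ring.zero I_infty = ring.zero Q_module"
  "module.smult I_infty = module.smult Q_module"
  by (simp_all add: I_infty_def)

lemma R_tilde_mem [simp]: "qq (fps_to_fls a) d \<in> carrier R_tilde"
  by (auto simp: R_tilde_carrier)

lemma R_tilde_mem_0_1 [simp]: "qq 0 d \<in> carrier R_tilde" "qq 1 d \<in> carrier R_tilde"
  using R_tilde_mem[of 0 d] R_tilde_mem[of 1 d] by simp_all

lemma I_infty_mem [simp]: "qq 0 (fps_to_fls d) \<in> carrier I_infty"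
  by (auto simp: I_infty_carrier)

lemma I_infty_mem_0_1 [simp]: "qq 0 0 \<in> carrier I_infty" "qq 0 1 \<in> carrier I_infty"
  using I_infty_mem[of 0] I_infty_mem[of 1] by simp_all

lemma R_tilde_CM: "CM_module R_tilde"
proof -
  have "CM_module (Q_module\<lparr>carrier := carrier (R_tilde :: ('a rxy, 'a qxy) module)\<rparr>)"
  proof (rule Q_submodule_CM)
    show "z \<oplus>\<^bsub>Q_module\<^esub> w \<in> carrier R_tilde" if "z \<in> carrier R_tilde" "w \<in> carrier R_tilde"
      for z w :: "'a qxy"
      using that by (auto simp: R_tilde_carrier simp flip: fps_to_fls_plus)
    show "rr a b \<odot>\<^bsub>Q_module\<^esub> z \<in> carrier R_tilde" if "z \<in> carrier R_tilde" for a b and z :: "'a qxy"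
      using that by (auto simp: R_tilde_carrier simp flip: fls_times_fps_to_fls)
  qed (auto simp: R_tilde_carrier)
  then show ?thesis by (simp add: R_tilde_def)
qed

lemma I_infty_CM: "CM_module I_infty"
proof -
  have "CM_module (Q_module\<lparr>carrier := carrier (I_infty :: ('a rxy, 'a qxy) module)\<rparr>)"
  proof (rule Q_submodule_CM)
    show "z \<oplus>\<^bsub>Q_module\<^esub> w \<in> carrier I_infty" if "z \<in> carrier I_infty" "w \<in> carrier I_infty"
      for z w :: "'a qxy"
      using that by (auto simp: I_infty_carrier simp flip: fps_to_fls_plus)
    show "rr a b \<odot>\<^bsub>Q_module\<^esub> z \<in> carrier I_infty" if "z \<in> carrier I_infty" for a b and z :: "'a qxy"
      using that by (auto simp: I_infty_carrier simp flip: fls_times_fps_to_fls)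
  qed (auto simp: I_infty_carrier)
  then show ?thesis by (simp add: I_infty_def)
qed

lemma CM_module_module: "CM_module N \<Longrightarrow> module R_ring N"
  by (simp add: CM_module_def)

lemmas R_tilde_module = CM_module_module[OF R_tilde_CM]
lemmas I_infty_module = CM_module_module[OF I_infty_CM]

section \<open>Endomorphisms of \<open>R_tilde\<close> and \<open>I_infty\<close> as multiplications
  in \<open>Q\<close>\<close>

lemma R_tilde_cases:
  assumes "z \<in> carrier R_tilde"
  obtains a d where "z = qq (fps_to_fls a) d"
  using assms by (auto simp: R_tilde_carrier)

lemma I_infty_cases:
  assumes "z \<in> carrier I_infty"
  obtains d where "z = qq 0 (fps_to_fls d)"
  using assms by (auto simp: I_infty_carrier)

text \<open>\<open>V + xL\<close> is a subring of \<open>Q\<close>, so it is stable under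
  multiplication by its own elements.\<close>

lemma R_tilde_mult_endo:
  "(\<lambda>z \<in> carrier R_tilde. z \<otimes>\<^bsub>Q_ring\<^esub> qq (fps_to_fls u) v) \<in> mod_hom R_ring R_tilde R_tilde"
proof (rule mod_homI)
  show "z \<otimes>\<^bsub>Q_ring\<^esub> qq (fps_to_fls u) v \<in> carrier R_tilde" if "z \<in> carrier R_tilde" for z
    using that by (auto simp: R_tilde_carrier simp flip: fls_times_fps_to_fls)
qed (auto simp: R_tilde_module R_tilde_carrier R_carrier algebra_simps)

lemma I_infty_mult_endo:
  "(\<lambda>z \<in> carrier I_infty. z \<otimes>\<^bsub>Q_ring\<^esub> qq (fps_to_fls u) v) \<in> mod_hom R_ring I_infty I_infty"
proof (rule mod_homI)
  show "z \<otimes>\<^bsub>Q_ring\<^esub> qq (fps_to_fls u) v \<in> carrier I_infty" if "z \<in> carrier I_infty" for z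
    using that by (auto simp: I_infty_carrier simp flip: fls_times_fps_to_fls)
qed (auto simp: I_infty_module I_infty_carrier R_carrier algebra_simps)

text \<open>The element 1 does not generate \<open>R_tilde\<close>, but a power of \<open>y\<close>
  moves any given \<open>z\<close> into \<open>R 1\<close>. Linearity then determines
  \<open>y^n h z\<close> from \<open>h 1\<close>, and \<open>y^n\<close> cancels in
  \<open>Q\<close>.\<close>

lemma R_tilde_endo:
  fixes h :: "'k::field qxy \<Rightarrow> 'k qxy"
  assumes h: "h \<in> mod_hom R_ring R_tilde R_tilde"
  obtains u v where "h = (\<lambda>z \<in> carrier R_tilde. z \<otimes>\<^bsub>Q_ring\<^esub> qq (fps_to_fls u) v)"
proof -
  have "h (qq 1 0) \<in> carrier R_tilde" using h by (simp add: mod_homD)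
  then obtain u v where uv: "h (qq 1 0) = qq (fps_to_fls u) v" by (rule R_tilde_cases)
  have "h z = z \<otimes>\<^bsub>Q_ring\<^esub> qq (fps_to_fls u) v" if z: "z \<in> carrier R_tilde" for z
  proof -
    obtain a d where ad: "z = qq (fps_to_fls a) d" using z by (rule R_tilde_cases)
    obtain b n where b: "fps_to_fls b = d * fls_X ^ n" using ex_fls_numerator by blast
    obtain p q where pq: "h z = qq p q" using mod_homD(1)[OF h z] by (rule R_tilde_cases)
    have "rr (fps_X ^ n) 0 \<odot>\<^bsub>Q_module\<^esub> z = rr (fps_X ^ n * a) b \<odot>\<^bsub>Q_module\<^esub> qq 1 0"
      using b by (simp add: ad fls_times_fps_to_fls fps_to_fls_power mult.commute)
    then have "rr (fps_X ^ n) 0 \<odot>\<^bsub>R_tilde\<^esub> z = rr (fps_X ^ n * a) b \<odot>\<^bsub>R_tilde\<^esub> qq 1 0"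
      by simp
    then have "rr (fps_X ^ n) 0 \<odot>\<^bsub>R_tilde\<^esub> h z = rr (fps_X ^ n * a) b \<odot>\<^bsub>R_tilde\<^esub> h (qq 1 0)"
      by (metis mod_homD(3)[OF h] rr_closed z R_tilde_mem_0_1(2))
    then have "rr (fps_X ^ n) 0 \<odot>\<^bsub>Q_module\<^esub> qq p q =
        rr (fps_X ^ n * a) b \<odot>\<^bsub>Q_module\<^esub> qq (fps_to_fls u) v"
      by (simp add: pq uv)
    then have "fls_X ^ n * p = fls_X ^ n * (fps_to_fls a * fps_to_fls u)"
      "fls_X ^ n * q = fls_X ^ n * (fps_to_fls a * v + d * fps_to_fls u)"
      using b by (simp_all add: fls_times_fps_to_fls fps_to_fls_power algebra_simps)
    then show ?thesis by (simp add: pq[unfolded ad] ad)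
  qed
  then have "h = (\<lambda>z \<in> carrier R_tilde. z \<otimes>\<^bsub>Q_ring\<^esub> qq (fps_to_fls u) v)"
    by (intro mod_hom_eqI[OF h R_tilde_mult_endo]) simp
  then show thesis by (rule that)
qed

text \<open>\<open>I_infty\<close> is cyclic, generated by \<open>x = qq 0 1\<close>, so the image
  of this generator decides everything.\<close>

lemma I_infty_endo:
  fixes h :: "'k::field qxy \<Rightarrow> 'k qxy"
  assumes h: "h \<in> mod_hom R_ring I_infty I_infty"
  obtains u where "h = (\<lambda>z \<in> carrier I_infty. z \<otimes>\<^bsub>Q_ring\<^esub> qq (fps_to_fls u) 0)"
proof -
  have "h (qq 0 1) \<in> carrier I_infty" using h by (simp add: mod_homD)
  then obtain u where u: "h (qq 0 1) = qq 0 (fps_to_fls u)" by (rule I_infty_cases)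
  have "h z = z \<otimes>\<^bsub>Q_ring\<^esub> qq (fps_to_fls u) 0" if z: "z \<in> carrier I_infty" for z
  proof -
    obtain d where d: "z = qq 0 (fps_to_fls d)" using z by (rule I_infty_cases)
    then have "z = rr d 0 \<odot>\<^bsub>I_infty\<^esub> qq 0 1" by simp
    then have "h z = rr d 0 \<odot>\<^bsub>I_infty\<^esub> h (qq 0 1)"
      by (metis mod_homD(3)[OF h] rr_closed I_infty_mem_0_1(2))
    then show ?thesis by (simp add: u d[symmetric]) (simp add: d)
  qed
  then have "h = (\<lambda>z \<in> carrier I_infty. z \<otimes>\<^bsub>Q_ring\<^esub> qq (fps_to_fls u) 0)"
    by (intro mod_hom_eqI[OF h I_infty_mult_endo]) simp
  then show thesis by (rule that)
qed

text \<open>Because \<open>x^2 = 0\<close>, the inverse of \<open>u + v x\<close> is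
  \<open>u^-1 - v u^-2 x\<close>, and a nonzero constant term makes \<open>u^-1\<close> a power
  series. Both orders are needed for two-sided units.\<close>

lemma qq_mult_inverse:
  fixes u :: "'k::field fps"
  assumes "u $ 0 \<noteq> 0"
  shows "qq c d \<otimes>\<^bsub>Q_ring\<^esub> qq (fps_to_fls u) v \<otimes>\<^bsub>Q_ring\<^esub>
      qq (fps_to_fls (inverse u)) (- v * fps_to_fls (inverse u) * fps_to_fls (inverse u)) = qq c d"
    "qq c d \<otimes>\<^bsub>Q_ring\<^esub>
      qq (fps_to_fls (inverse u)) (- v * fps_to_fls (inverse u) * fps_to_fls (inverse u))
      \<otimes>\<^bsub>Q_ring\<^esub> qq (fps_to_fls u) v = qq c d"
proof -
  define j where "j = fps_to_fls u"
  define i where "i = fps_to_fls (inverse u)"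
  have ij: "j * i = 1" using inverse_mult_eq_1'[OF assms]
    by (simp add: i_def j_def flip: fls_times_fps_to_fls)
  then have j: "j \<noteq> 0" by auto
  with ij have i: "i = 1 / j" by (simp add: field_simps)
  show "qq c d \<otimes>\<^bsub>Q_ring\<^esub> qq (fps_to_fls u) v \<otimes>\<^bsub>Q_ring\<^esub>
      qq (fps_to_fls (inverse u)) (- v * fps_to_fls (inverse u) * fps_to_fls (inverse u)) = qq c d"
    "qq c d \<otimes>\<^bsub>Q_ring\<^esub>
      qq (fps_to_fls (inverse u)) (- v * fps_to_fls (inverse u) * fps_to_fls (inverse u))
      \<otimes>\<^bsub>Q_ring\<^esub> qq (fps_to_fls u) v = qq c d"
    unfolding i_def[symmetric] j_def[symmetric] i using j by (simp_all add: field_simps)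
qed

text \<open>Every endomorphism is multiplication by some \<open>u + v x\<close>, and the character
  sends it to the residue \<open>u $ 0\<close>; when this is nonzero, \<open>qq_mult_inverse\<close>
  gives the inverse.\<close>

lemma End_R_tilde_local: "local_ring (End_ring R_ring (R_tilde :: ('k::field rxy, 'k qxy) module))"
proof (rule local_ringI_character)
  let ?E = "End_ring R_ring (R_tilde :: ('k rxy, 'k qxy) module)"
  let ?\<chi> = "\<lambda>h. fls_nth (qfst (h (qq 1 0))) 0 :: 'k"
  have endo: "\<exists>u v. f = (\<lambda>z \<in> carrier R_tilde. z \<otimes>\<^bsub>Q_ring\<^esub> qq (fps_to_fls u) v)"
    if "f \<in> carrier ?E" for f
  proof -
    have f: "f \<in> mod_hom R_ring R_tilde R_tilde" using that by (simp add: End_ring_def)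
    from f obtain u v where "f = (\<lambda>z \<in> carrier R_tilde. z \<otimes>\<^bsub>Q_ring\<^esub> qq (fps_to_fls u) v)"
      by (rule R_tilde_endo)
    then show ?thesis by blast
  qed
  show "ring ?E" by (rule End_ring_ring[OF R_tilde_module])
  show "?\<chi> (f \<oplus>\<^bsub>?E\<^esub> g) = ?\<chi> f + ?\<chi> g" "?\<chi> (f \<otimes>\<^bsub>?E\<^esub> g) = ?\<chi> f * ?\<chi> g"
    if fg: "f \<in> carrier ?E" "g \<in> carrier ?E" for f g
  proof -
    obtain u v where "f = (\<lambda>z \<in> carrier R_tilde. z \<otimes>\<^bsub>Q_ring\<^esub> qq (fps_to_fls u) v)"
      using endo[OF fg(1)] by blast
    moreover obtain u' v' where "g = (\<lambda>z \<in> carrier R_tilde. z \<otimes>\<^bsub>Q_ring\<^esub> qq (fps_to_fls u') v')"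
      using endo[OF fg(2)] by blast
    ultimately show "?\<chi> (f \<oplus>\<^bsub>?E\<^esub> g) = ?\<chi> f + ?\<chi> g" "?\<chi> (f \<otimes>\<^bsub>?E\<^esub> g) = ?\<chi> f * ?\<chi> g"
      by (simp_all add: End_ring_def compose_def mult.commute flip: fls_times_fps_to_fls)
  qed
  show "?\<chi> \<one>\<^bsub>?E\<^esub> = 1" by (simp add: End_ring_def mod_id_def)
  show "f \<in> Units ?E" if f: "f \<in> carrier ?E" "?\<chi> f \<noteq> 0" for f
  proof -
    obtain u v where uv: "f = (\<lambda>z \<in> carrier R_tilde. z \<otimes>\<^bsub>Q_ring\<^esub> qq (fps_to_fls u) v)"
      using endo[OF f(1)] by blast
    then have u: "u $ 0 \<noteq> 0" using f(2) by simp
    define v' where "v' = - v * fps_to_fls (inverse u) * fps_to_fls (inverse u)"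
    define g where "g = (\<lambda>z \<in> carrier R_tilde. z \<otimes>\<^bsub>Q_ring\<^esub> qq (fps_to_fls (inverse u)) v')"
    have g: "g \<in> mod_hom R_ring R_tilde R_tilde" unfolding g_def by (rule R_tilde_mult_endo)
    have f': "f \<in> mod_hom R_ring R_tilde R_tilde" unfolding uv by (rule R_tilde_mult_endo)
    have "g (f z) = z" "f (g z) = z" if z: "z \<in> carrier R_tilde" for z
    proof -
      have "f z \<in> carrier R_tilde" "g z \<in> carrier R_tilde" using f' g z by (simp_all add: mod_homD)
      moreover obtain a d where "z = qq (fps_to_fls a) d" using z by (rule R_tilde_cases)
      ultimately show "g (f z) = z" "f (g z) = z"
        using z qq_mult_inverse[OF u] by (simp_all add: uv g_def v'_def del: qq_mult)
    qed
    then have "compose (carrier R_tilde) g f = mod_id R_tilde" "compose (carrier R_tilde) f g = mod_id R_tilde"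
      by (auto simp: compose_def mod_id_def intro: restrict_ext)
    then show ?thesis using g f' by (auto simp: Units_def End_ring_def)
  qed
qed

text \<open>The endomorphisms are multiplications by \<open>u\<close> in \<open>k[[y]]\<close>. The
  residue \<open>u $ 0\<close> is read off the \<open>x\<close>-coordinate of the image of the
  generator \<open>x\<close>.\<close>

lemma End_I_infty_local: "local_ring (End_ring R_ring (I_infty :: ('k::field rxy, 'k qxy) module))"
proof (rule local_ringI_character)
  let ?E = "End_ring R_ring (I_infty :: ('k rxy, 'k qxy) module)"
  let ?\<chi> = "\<lambda>h. fls_nth (qsnd (h (qq 0 1))) 0 :: 'k"
  have endo: "\<exists>u. f = (\<lambda>z \<in> carrier I_infty. z \<otimes>\<^bsub>Q_ring\<^esub> qq (fps_to_fls u) 0)"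
    if "f \<in> carrier ?E" for f
  proof -
    have f: "f \<in> mod_hom R_ring I_infty I_infty" using that by (simp add: End_ring_def)
    from f obtain u where "f = (\<lambda>z \<in> carrier I_infty. z \<otimes>\<^bsub>Q_ring\<^esub> qq (fps_to_fls u) 0)"
      by (rule I_infty_endo)
    then show ?thesis by blast
  qed
  show "ring ?E" by (rule End_ring_ring[OF I_infty_module])
  show "?\<chi> (f \<oplus>\<^bsub>?E\<^esub> g) = ?\<chi> f + ?\<chi> g" "?\<chi> (f \<otimes>\<^bsub>?E\<^esub> g) = ?\<chi> f * ?\<chi> g"
    if fg: "f \<in> carrier ?E" "g \<in> carrier ?E" for f g
  proof -
    obtain u where "f = (\<lambda>z \<in> carrier I_infty. z \<otimes>\<^bsub>Q_ring\<^esub> qq (fps_to_fls u) 0)"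
      using endo[OF fg(1)] by blast
    moreover obtain u' where "g = (\<lambda>z \<in> carrier I_infty. z \<otimes>\<^bsub>Q_ring\<^esub> qq (fps_to_fls u') 0)"
      using endo[OF fg(2)] by blast
    ultimately show "?\<chi> (f \<oplus>\<^bsub>?E\<^esub> g) = ?\<chi> f + ?\<chi> g" "?\<chi> (f \<otimes>\<^bsub>?E\<^esub> g) = ?\<chi> f * ?\<chi> g"
      by (simp_all add: End_ring_def compose_def mult.commute flip: fls_times_fps_to_fls)
  qed
  show "?\<chi> \<one>\<^bsub>?E\<^esub> = 1" by (simp add: End_ring_def mod_id_def)
  show "f \<in> Units ?E" if f: "f \<in> carrier ?E" "?\<chi> f \<noteq> 0" for f
  proof -
    obtain u where uv: "f = (\<lambda>z \<in> carrier I_infty. z \<otimes>\<^bsub>Q_ring\<^esub> qq (fps_to_fls u) 0)"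
      using endo[OF f(1)] by blast
    then have u: "u $ 0 \<noteq> 0" using f(2) by simp
    define g where "g = (\<lambda>z \<in> carrier I_infty. z \<otimes>\<^bsub>Q_ring\<^esub> qq (fps_to_fls (inverse u)) 0)"
    have g: "g \<in> mod_hom R_ring I_infty I_infty" unfolding g_def by (rule I_infty_mult_endo)
    have f': "f \<in> mod_hom R_ring I_infty I_infty" unfolding uv by (rule I_infty_mult_endo)
    have "g (f z) = z" "f (g z) = z" if z: "z \<in> carrier I_infty" for z
    proof -
      have "f z \<in> carrier I_infty" "g z \<in> carrier I_infty" using f' g z by (simp_all add: mod_homD)
      moreover obtain d where "z = qq 0 (fps_to_fls d)" using z by (rule I_infty_cases)
      ultimately show "g (f z) = z" "f (g z) = z"
        using z qq_mult_inverse[OF u, of _ _ 0] by (simp_all add: uv g_def del: qq_mult)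
    qed
    then have "compose (carrier I_infty) g f = mod_id I_infty" "compose (carrier I_infty) f g = mod_id I_infty"
      by (auto simp: compose_def mod_id_def intro: restrict_ext)
    then show ?thesis using g f' by (auto simp: Units_def End_ring_def)
  qed
qed

section \<open>Lifting residue functionals to \<open>R_tilde\<close>\<close>

lemma rr_ring_hom: "(\<lambda>a. rr a 0) \<in> ring_hom ring_of_type_algebra R_ring"
  by (auto simp: ring_hom_def ring_of_type_algebra_def R_one)

lemma rr_const_ring_hom: "(\<lambda>c. rr (fps_const c) 0) \<in> ring_hom ring_of_type_algebra R_ring"
  by (auto simp: ring_hom_def ring_of_type_algebra_def R_one)

lemma fps_const_shift_decompose:
  fixes a :: "'k::field fps"
  shows "a = fps_const (a $ 0) + fps_X * fps_shift 1 a"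
  by (rule fps_ext) (simp)

context
  fixes N :: "('k::field rxy, 'n) module"
  assumes CM: "CM_module N"
begin

interpretation N: module R_ring N
  using CM by (rule CM_module_module)

lemma rr_smult [simp]:
  assumes "n \<in> carrier N"
  shows "rr a b \<odot>\<^bsub>N\<^esub> (rr c d \<odot>\<^bsub>N\<^esub> n) = rr (a * c) (a * d + b * c) \<odot>\<^bsub>N\<^esub> n"
    and "rr 1 0 \<odot>\<^bsub>N\<^esub> n = n" and "rr 0 0 \<odot>\<^bsub>N\<^esub> n = \<zero>\<^bsub>N\<^esub>"
  using assms N.smult_assoc1[of "rr a b" "rr c d" n] N.smult_one[of n] N.smult_l_null[of n]
  by (simp_all add: R_one R_zero)

lemma rr_smult_add:
  "n \<in> carrier N \<Longrightarrow> rr a b \<odot>\<^bsub>N\<^esub> n \<oplus>\<^bsub>N\<^esub> rr c d \<odot>\<^bsub>N\<^esub> n = rr (a + c) (b + d) \<odot>\<^bsub>N\<^esub> n"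
  using N.smult_l_distr[of "rr a b" "rr c d" n] by simp

lemma y_smult_cancel:
  assumes "n \<in> carrier N" "rr fps_X 0 \<odot>\<^bsub>N\<^esub> n = \<zero>\<^bsub>N\<^esub>"
  shows "n = \<zero>\<^bsub>N\<^esub>"
  using assms CM CM_module_iff[OF N.module_axioms] by (simp add: R_y_eq)

section \<open>The submodule \<open>K\<close> and the functionals that vanish on it\<close>

definition x_torsion :: "'n set" where
  "x_torsion = {n \<in> carrier N. rr 0 1 \<odot>\<^bsub>N\<^esub> n = \<zero>\<^bsub>N\<^esub>}"

lemma x_torsionD: "k \<in> x_torsion \<Longrightarrow> k \<in> carrier N"
  by (simp add: x_torsion_def)

text \<open>The last clause, \<open>xN\<close> inside \<open>K\<close>, is where
  \<open>x^2 = 0\<close> enters.\<close>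

lemma x_torsion_closed:
  "\<zero>\<^bsub>N\<^esub> \<in> x_torsion"
  "k \<in> x_torsion \<Longrightarrow> k' \<in> x_torsion \<Longrightarrow> k \<oplus>\<^bsub>N\<^esub> k' \<in> x_torsion"
  "k \<in> x_torsion \<Longrightarrow> rr a 0 \<odot>\<^bsub>N\<^esub> k \<in> x_torsion"
  "n \<in> carrier N \<Longrightarrow> rr 0 b \<odot>\<^bsub>N\<^esub> n \<in> x_torsion"
proof -
  show "rr a 0 \<odot>\<^bsub>N\<^esub> k \<in> x_torsion" if k: "k \<in> x_torsion"
  proof -
    have "rr 0 1 \<odot>\<^bsub>N\<^esub> (rr a 0 \<odot>\<^bsub>N\<^esub> k) = rr a 0 \<odot>\<^bsub>N\<^esub> (rr 0 1 \<odot>\<^bsub>N\<^esub> k)"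
      using k by (simp add: x_torsionD)
    then show ?thesis using k by (simp add: x_torsion_def del: rr_smult)
  qed
qed (auto simp: x_torsion_def N.smult_r_distr)

text \<open>These are the \<open>R\<close>-linear maps from \<open>N\<close> to the residue field
  \<open>R/(x, y)\<close> that vanish on \<open>K\<close>; \<open>rr a b\<close> acts on that field
  as \<open>a $ 0\<close>.\<close>

definition residue_functional :: "('n \<Rightarrow> 'k) \<Rightarrow> bool" where
  "residue_functional \<phi> \<longleftrightarrow>
     (\<forall>m \<in> carrier N. \<forall>n \<in> carrier N. \<phi> (m \<oplus>\<^bsub>N\<^esub> n) = \<phi> m + \<phi> n) \<and>
     (\<forall>a b. \<forall>n \<in> carrier N. \<phi> (rr a b \<odot>\<^bsub>N\<^esub> n) = a $ 0 * \<phi> n) \<and>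
     (\<forall>k \<in> x_torsion. \<phi> k = 0)"

abbreviation N_k :: "('k, 'n) module" where
  "N_k \<equiv> restrict_scalars (\<lambda>c. rr (fps_const c) 0) N"

abbreviation N_V :: "('k fps, 'n) module" where
  "N_V \<equiv> restrict_scalars (\<lambda>a. rr a 0) N"

lemma N_k_module: "module ring_of_type_algebra N_k"
  by (rule module_restrict_scalars[OF N.module_axioms rr_const_ring_hom cring_from_type_algebra])

lemma N_V_module: "module ring_of_type_algebra N_V"
  by (rule module_restrict_scalars[OF N.module_axioms rr_ring_hom cring_from_type_algebra])

text \<open>Linear algebra over \<open>k\<close>: a vector outside the subspace
  \<open>K + yN\<close> is separated from it by a functional. The starting graph sends
  \<open>K + yN\<close> to 0 and \<open>n0\<close> to 1.\<close>

lemma residue_functional_exists: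
  assumes n0: "n0 \<in> carrier N"
    and not: "\<And>k n. k \<in> x_torsion \<Longrightarrow> n \<in> carrier N \<Longrightarrow> n0 \<noteq> k \<oplus>\<^bsub>N\<^esub> rr fps_X 0 \<odot>\<^bsub>N\<^esub> n"
  obtains \<phi> where "residue_functional \<phi>" "\<phi> n0 = 1"
proof -
  define G where "G = {(k \<oplus>\<^bsub>N\<^esub> rr fps_X 0 \<odot>\<^bsub>N\<^esub> n \<oplus>\<^bsub>N\<^esub> rr (fps_const c) 0 \<odot>\<^bsub>N\<^esub> n0, c) | k n c.
    k \<in> x_torsion \<and> n \<in> carrier N}"
  note tc = x_torsionD x_torsion_closed
  have GI: "(k \<oplus>\<^bsub>N\<^esub> rr fps_X 0 \<odot>\<^bsub>N\<^esub> n \<oplus>\<^bsub>N\<^esub> rr (fps_const c) 0 \<odot>\<^bsub>N\<^esub> n0, c) \<in> G"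
    if "k \<in> x_torsion" "n \<in> carrier N" for k n c
    using that unfolding G_def by blast
  have GE: "\<exists>k n. m = k \<oplus>\<^bsub>N\<^esub> rr fps_X 0 \<odot>\<^bsub>N\<^esub> n \<oplus>\<^bsub>N\<^esub> rr (fps_const c) 0 \<odot>\<^bsub>N\<^esub> n0 \<and>
      k \<in> x_torsion \<and> n \<in> carrier N" if "(m, c) \<in> G" for m c
    using that unfolding G_def by blast
  have "semilinear_graph id N_k G"
    unfolding semilinear_graph_def
  proof (intro conjI allI impI)
    show "G \<noteq> {}" using GI[OF tc(2) N.zero_closed] by blast
    show "m \<in> carrier N_k" if "(m, c) \<in> G" for m c
      using GE[OF that] n0 by (auto simp: tc)
    show "(m \<oplus>\<^bsub>N_k\<^esub> m', c + c') \<in> G" if mc: "(m, c) \<in> G" and mc': "(m', c') \<in> G" for m c m' c'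
    proof -
      obtain k n where kn: "m = k \<oplus>\<^bsub>N\<^esub> rr fps_X 0 \<odot>\<^bsub>N\<^esub> n \<oplus>\<^bsub>N\<^esub> rr (fps_const c) 0 \<odot>\<^bsub>N\<^esub> n0"
        "k \<in> x_torsion" "n \<in> carrier N" using GE[OF mc] by blast
      obtain k' n' where kn': "m' = k' \<oplus>\<^bsub>N\<^esub> rr fps_X 0 \<odot>\<^bsub>N\<^esub> n' \<oplus>\<^bsub>N\<^esub> rr (fps_const c') 0 \<odot>\<^bsub>N\<^esub> n0"
        "k' \<in> x_torsion" "n' \<in> carrier N" using GE[OF mc'] by blast
      have "rr (fps_const (c + c')) 0 \<odot>\<^bsub>N\<^esub> n0 =
          rr (fps_const c) 0 \<odot>\<^bsub>N\<^esub> n0 \<oplus>\<^bsub>N\<^esub> rr (fps_const c') 0 \<odot>\<^bsub>N\<^esub> n0"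
        using n0 by (simp add: rr_smult_add)
      then have "m \<oplus>\<^bsub>N\<^esub> m' = (k \<oplus>\<^bsub>N\<^esub> k') \<oplus>\<^bsub>N\<^esub> rr fps_X 0 \<odot>\<^bsub>N\<^esub> (n \<oplus>\<^bsub>N\<^esub> n') \<oplus>\<^bsub>N\<^esub>
          rr (fps_const (c + c')) 0 \<odot>\<^bsub>N\<^esub> n0"
        using kn kn' n0 by (simp add: N.smult_r_distr N.M.a_ac tc)
      then show ?thesis using GI[of "k \<oplus>\<^bsub>N\<^esub> k'" "n \<oplus>\<^bsub>N\<^esub> n'" "c + c'"] kn kn' by (simp add: tc)
    qed
    show "(a \<odot>\<^bsub>N_k\<^esub> m, id a * c) \<in> G" if mc: "(m, c) \<in> G" for a m c
    proof -
      obtain k n where kn: "m = k \<oplus>\<^bsub>N\<^esub> rr fps_X 0 \<odot>\<^bsub>N\<^esub> n \<oplus>\<^bsub>N\<^esub> rr (fps_const c) 0 \<odot>\<^bsub>N\<^esub> n0"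
        "k \<in> x_torsion" "n \<in> carrier N" using GE[OF mc] by blast
      have "rr (fps_const a) 0 \<odot>\<^bsub>N\<^esub> m = rr (fps_const a) 0 \<odot>\<^bsub>N\<^esub> k \<oplus>\<^bsub>N\<^esub>
          rr fps_X 0 \<odot>\<^bsub>N\<^esub> (rr (fps_const a) 0 \<odot>\<^bsub>N\<^esub> n) \<oplus>\<^bsub>N\<^esub> rr (fps_const (a * c)) 0 \<odot>\<^bsub>N\<^esub> n0"
        using kn n0 by (simp add: N.smult_r_distr tc mult.commute)
      then show ?thesis
        using GI[of "rr (fps_const a) 0 \<odot>\<^bsub>N\<^esub> k" "rr (fps_const a) 0 \<odot>\<^bsub>N\<^esub> n" "a * c"] kn
        by (simp add: tc del: rr_smult)
    qed
    show "c = 0" if zc: "(\<zero>\<^bsub>N_k\<^esub>, c) \<in> G" for c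
    proof (rule ccontr)
      assume c: "c \<noteq> 0"
      obtain k n where kn: "\<zero>\<^bsub>N\<^esub> = k \<oplus>\<^bsub>N\<^esub> rr fps_X 0 \<odot>\<^bsub>N\<^esub> n \<oplus>\<^bsub>N\<^esub> rr (fps_const c) 0 \<odot>\<^bsub>N\<^esub> n0"
        "k \<in> x_torsion" "n \<in> carrier N" using GE[OF zc] by auto
      \<comment> \<open>Multiplying the relation by \<open>u\<close> turns the coefficient of
        \<open>n0\<close> into -1; adding \<open>n0\<close> then exhibits it in
        \<open>K + yN\<close>, against the assumption.\<close>
      define u where "u = fps_const (- inverse c)"
      have "n0 = rr u 0 \<odot>\<^bsub>N\<^esub> \<zero>\<^bsub>N\<^esub> \<oplus>\<^bsub>N\<^esub> n0" using n0 by simp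
      also have "\<dots> = rr u 0 \<odot>\<^bsub>N\<^esub> k \<oplus>\<^bsub>N\<^esub> rr fps_X 0 \<odot>\<^bsub>N\<^esub> (rr u 0 \<odot>\<^bsub>N\<^esub> n) \<oplus>\<^bsub>N\<^esub>
          (rr (u * fps_const c) 0 \<odot>\<^bsub>N\<^esub> n0 \<oplus>\<^bsub>N\<^esub> rr 1 0 \<odot>\<^bsub>N\<^esub> n0)"
        unfolding kn(1) using kn(2,3) n0 by (simp add: N.smult_r_distr tc mult.commute N.M.a_ac)
      also have "rr (u * fps_const c) 0 \<odot>\<^bsub>N\<^esub> n0 \<oplus>\<^bsub>N\<^esub> rr 1 0 \<odot>\<^bsub>N\<^esub> n0 = \<zero>\<^bsub>N\<^esub>"
        using c n0 by (simp only: rr_smult_add) (simp add: u_def flip: fps_const_neg)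
      finally have "n0 = rr u 0 \<odot>\<^bsub>N\<^esub> k \<oplus>\<^bsub>N\<^esub> rr fps_X 0 \<odot>\<^bsub>N\<^esub> (rr u 0 \<odot>\<^bsub>N\<^esub> n)"
        using kn(2,3) by (simp add: tc)
      then show False using not[of "rr u 0 \<odot>\<^bsub>N\<^esub> k" "rr u 0 \<odot>\<^bsub>N\<^esub> n"] kn by (simp add: tc del: rr_smult)
    qed
  qed
  then obtain \<phi> where \<phi>: "semilinear id N_k \<phi>" "\<And>m c. (m, c) \<in> G \<Longrightarrow> \<phi> m = c"
    by (rule semilinear_extend[OF N_k_module, rotated 4]) auto
  have add: "\<phi> (m \<oplus>\<^bsub>N\<^esub> n) = \<phi> m + \<phi> n" if "m \<in> carrier N" "n \<in> carrier N" for m n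
    using \<phi>(1) that by (simp add: semilinear_def)
  have scale: "\<phi> (rr (fps_const c) 0 \<odot>\<^bsub>N\<^esub> n) = c * \<phi> n" if "n \<in> carrier N" for c n
    using \<phi>(1) that by (simp add: semilinear_def)
  have zero: "\<phi> (k \<oplus>\<^bsub>N\<^esub> rr fps_X 0 \<odot>\<^bsub>N\<^esub> n) = 0" if "k \<in> x_torsion" "n \<in> carrier N" for k n
    using \<phi>(2)[OF GI[OF that, of 0]] that n0 by (simp add: tc)
  have "\<phi> n0 = 1"
    using \<phi>(2)[OF GI[OF tc(2) N.zero_closed, of 1]] n0 by simp
  moreover have "residue_functional \<phi>"
    unfolding residue_functional_def
  proof (intro conjI ballI allI)
    show "\<phi> k = 0" if "k \<in> x_torsion" for k using zero[OF that N.zero_closed] that by (simp add: tc)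
    fix a b n assume n: "n \<in> carrier N"
    \<comment> \<open>Apart from its constant term, the scalar \<open>a + b x\<close> maps
      \<open>n\<close> into \<open>K + yN\<close>, so \<phi> sees only \<open>a $ 0\<close>.\<close>
    have "rr 0 b \<odot>\<^bsub>N\<^esub> n \<oplus>\<^bsub>N\<^esub> rr fps_X 0 \<odot>\<^bsub>N\<^esub> (rr (fps_shift 1 a) 0 \<odot>\<^bsub>N\<^esub> n) =
        rr (fps_X * fps_shift 1 a) b \<odot>\<^bsub>N\<^esub> n"
      using n by (simp add: rr_smult_add)
    then have "\<phi> (rr (fps_X * fps_shift 1 a) b \<odot>\<^bsub>N\<^esub> n) = 0"
      using zero[of "rr 0 b \<odot>\<^bsub>N\<^esub> n" "rr (fps_shift 1 a) 0 \<odot>\<^bsub>N\<^esub> n"] n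
      by (simp add: tc del: rr_smult)
    moreover have "rr a b \<odot>\<^bsub>N\<^esub> n = rr (fps_const (a $ 0)) 0 \<odot>\<^bsub>N\<^esub> n \<oplus>\<^bsub>N\<^esub> rr (fps_X * fps_shift 1 a) b \<odot>\<^bsub>N\<^esub> n"
      using n fps_const_shift_decompose[of a] by (simp add: rr_smult_add)
    ultimately show "\<phi> (rr a b \<odot>\<^bsub>N\<^esub> n) = a $ 0 * \<phi> n"
      using n by (simp add: add scale)
  qed (use add in simp)
  ultimately show thesis using that by blast
qed

text \<open>Produces the next coefficient of the lift. On \<open>K + yN\<close> the value at
  \<open>k + y n\<close> has to be \<open>\<phi> n\<close>; the CM property makes this well defined,
  and extension over \<open>k\<close> does the rest.\<close>

lemma functional_divide_y:
  assumes \<phi>: "semilinear id N_k \<phi>" "\<And>k. k \<in> x_torsion \<Longrightarrow> \<phi> k = 0"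
  shows "\<exists>\<psi>. semilinear id N_k \<psi> \<and> (\<forall>k \<in> x_torsion. \<psi> k = 0) \<and>
    (\<forall>n \<in> carrier N. \<psi> (rr fps_X 0 \<odot>\<^bsub>N\<^esub> n) = \<phi> n)"
proof -
  define G where "G = {(k \<oplus>\<^bsub>N\<^esub> rr fps_X 0 \<odot>\<^bsub>N\<^esub> n, \<phi> n) | k n. k \<in> x_torsion \<and> n \<in> carrier N}"
  note tc = x_torsionD x_torsion_closed
  have add: "\<phi> (m \<oplus>\<^bsub>N\<^esub> n) = \<phi> m + \<phi> n" if "m \<in> carrier N" "n \<in> carrier N" for m n
    using \<phi>(1) that by (simp add: semilinear_def)
  have scale: "\<phi> (rr (fps_const c) 0 \<odot>\<^bsub>N\<^esub> n) = c * \<phi> n" if "n \<in> carrier N" for c n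
    using \<phi>(1) that by (simp add: semilinear_def)
  have GI: "(k \<oplus>\<^bsub>N\<^esub> rr fps_X 0 \<odot>\<^bsub>N\<^esub> n, \<phi> n) \<in> G" if "k \<in> x_torsion" "n \<in> carrier N" for k n
    using that unfolding G_def by blast
  have GE: "\<exists>k n. m = k \<oplus>\<^bsub>N\<^esub> rr fps_X 0 \<odot>\<^bsub>N\<^esub> n \<and> c = \<phi> n \<and> k \<in> x_torsion \<and> n \<in> carrier N"
    if "(m, c) \<in> G" for m c
    using that unfolding G_def by blast
  have "semilinear_graph id N_k G"
    unfolding semilinear_graph_def
  proof (intro conjI allI impI)
    show "G \<noteq> {}" using GI[OF tc(2) N.zero_closed] by blast
    show "m \<in> carrier N_k" if "(m, c) \<in> G" for m c
      using GE[OF that] by (auto simp: tc)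
    show "(m \<oplus>\<^bsub>N_k\<^esub> m', c + c') \<in> G" if mc: "(m, c) \<in> G" and mc': "(m', c') \<in> G" for m c m' c'
    proof -
      obtain k n where kn: "m = k \<oplus>\<^bsub>N\<^esub> rr fps_X 0 \<odot>\<^bsub>N\<^esub> n" "c = \<phi> n"
        "k \<in> x_torsion" "n \<in> carrier N" using GE[OF mc] by blast
      obtain k' n' where kn': "m' = k' \<oplus>\<^bsub>N\<^esub> rr fps_X 0 \<odot>\<^bsub>N\<^esub> n'" "c' = \<phi> n'"
        "k' \<in> x_torsion" "n' \<in> carrier N" using GE[OF mc'] by blast
      have "m \<oplus>\<^bsub>N\<^esub> m' = (k \<oplus>\<^bsub>N\<^esub> k') \<oplus>\<^bsub>N\<^esub> rr fps_X 0 \<odot>\<^bsub>N\<^esub> (n \<oplus>\<^bsub>N\<^esub> n')"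
        using kn kn' by (simp add: N.smult_r_distr N.M.a_ac tc)
      then show ?thesis using GI[of "k \<oplus>\<^bsub>N\<^esub> k'" "n \<oplus>\<^bsub>N\<^esub> n'"] kn kn' by (simp add: tc add)
    qed
    show "(a \<odot>\<^bsub>N_k\<^esub> m, id a * c) \<in> G" if mc: "(m, c) \<in> G" for a m c
    proof -
      obtain k n where kn: "m = k \<oplus>\<^bsub>N\<^esub> rr fps_X 0 \<odot>\<^bsub>N\<^esub> n" "c = \<phi> n"
        "k \<in> x_torsion" "n \<in> carrier N" using GE[OF mc] by blast
      have "rr (fps_const a) 0 \<odot>\<^bsub>N\<^esub> m = rr (fps_const a) 0 \<odot>\<^bsub>N\<^esub> k \<oplus>\<^bsub>N\<^esub>
          rr fps_X 0 \<odot>\<^bsub>N\<^esub> (rr (fps_const a) 0 \<odot>\<^bsub>N\<^esub> n)"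
        using kn by (simp add: N.smult_r_distr tc mult.commute)
      then show ?thesis
        using GI[of "rr (fps_const a) 0 \<odot>\<^bsub>N\<^esub> k" "rr (fps_const a) 0 \<odot>\<^bsub>N\<^esub> n"] kn
        by (simp add: tc scale del: rr_smult)
    qed
    show "c = 0" if zc: "(\<zero>\<^bsub>N_k\<^esub>, c) \<in> G" for c
    proof -
      obtain k n where kn: "\<zero>\<^bsub>N\<^esub> = k \<oplus>\<^bsub>N\<^esub> rr fps_X 0 \<odot>\<^bsub>N\<^esub> n" "c = \<phi> n"
        "k \<in> x_torsion" "n \<in> carrier N" using GE[OF zc] by auto
      \<comment> \<open>Multiplying \<open>k + y n = 0\<close> by \<open>x\<close> leaves
        \<open>y (x n) = 0\<close>. Hence \<open>x n = 0\<close>, so \<open>n\<close> lies in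
        \<open>K\<close>, where \<phi> vanishes.\<close>
      have "rr 0 1 \<odot>\<^bsub>N\<^esub> k \<oplus>\<^bsub>N\<^esub> rr fps_X 0 \<odot>\<^bsub>N\<^esub> (rr 0 1 \<odot>\<^bsub>N\<^esub> n) = \<zero>\<^bsub>N\<^esub>"
        using kn(3,4) arg_cong[OF kn(1), of "\<lambda>m. rr 0 1 \<odot>\<^bsub>N\<^esub> m", symmetric]
        by (simp add: N.smult_r_distr tc)
      moreover have "rr 0 1 \<odot>\<^bsub>N\<^esub> k = \<zero>\<^bsub>N\<^esub>" using kn(3) by (simp add: x_torsion_def)
      ultimately have "rr fps_X 0 \<odot>\<^bsub>N\<^esub> (rr 0 1 \<odot>\<^bsub>N\<^esub> n) = \<zero>\<^bsub>N\<^esub>"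
        using kn(4) by (simp del: rr_smult)
      then have "n \<in> x_torsion" using kn(4) by (simp add: y_smult_cancel x_torsion_def del: rr_smult)
      then show ?thesis using kn(2) \<phi>(2) by simp
    qed
  qed
  then obtain \<psi> where \<psi>: "semilinear id N_k \<psi>" "\<And>m c. (m, c) \<in> G \<Longrightarrow> \<psi> m = c"
    by (rule semilinear_extend[OF N_k_module, rotated 4]) auto
  have "\<psi> k = 0" if "k \<in> x_torsion" for k
    using \<psi>(2)[OF GI[OF that N.zero_closed]] that \<phi>(2)[OF tc(2)] by (simp add: tc)
  moreover have "\<psi> (rr fps_X 0 \<odot>\<^bsub>N\<^esub> n) = \<phi> n" if "n \<in> carrier N" for n
    using \<psi>(2)[OF GI[OF tc(2) that]] that by simp
  ultimately show ?thesis using \<psi>(1) by blast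
qed

text \<open>Iterating \<open>functional_divide_y\<close> from \<phi> gives the coefficients of
  \<alpha>. That coefficient \<open>i + 1\<close> at \<open>y n\<close> equals coefficient
  \<open>i\<close> at \<open>n\<close> says exactly that \<alpha> commutes with
  \<open>y\<close>.\<close>

lemma V_functional_lift:
  assumes \<phi>: "residue_functional \<phi>"
  obtains \<alpha> where "semilinear id N_V \<alpha>" "\<And>k. k \<in> x_torsion \<Longrightarrow> \<alpha> k = 0"
    "\<And>n. n \<in> carrier N \<Longrightarrow> \<alpha> n $ 0 = \<phi> n"
proof -
  define P where "P \<psi> \<longleftrightarrow> semilinear id N_k \<psi> \<and> (\<forall>k \<in> x_torsion. \<psi> k = 0)" for \<psi>
  have P_\<phi>: "P \<phi>"
    using \<phi> by (simp add: P_def residue_functional_def semilinear_def)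
  have "\<exists>\<psi>. P \<psi> \<and> (\<forall>n \<in> carrier N. \<psi> (rr fps_X 0 \<odot>\<^bsub>N\<^esub> n) = \<chi> n)" if "P \<chi>" for \<chi>
    using functional_divide_y[of \<chi>] that by (simp add: P_def conj_assoc)
  then obtain S where S: "\<And>\<chi>. P \<chi> \<Longrightarrow> P (S \<chi>)"
    "\<And>\<chi> n. P \<chi> \<Longrightarrow> n \<in> carrier N \<Longrightarrow> S \<chi> (rr fps_X 0 \<odot>\<^bsub>N\<^esub> n) = \<chi> n"
    by metis
  define \<Phi> where "\<Phi> i = (S ^^ i) \<phi>" for i
  have P: "P (\<Phi> i)" for i
    by (induction i) (simp_all add: \<Phi>_def P_\<phi> S(1))
  define \<alpha> where "\<alpha> n = Abs_fps (\<lambda>i. \<Phi> i n)" for n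
  have add: "\<alpha> (m \<oplus>\<^bsub>N\<^esub> n) = \<alpha> m + \<alpha> n" if "m \<in> carrier N" "n \<in> carrier N" for m n
    using P that by (intro fps_ext) (simp add: \<alpha>_def P_def semilinear_def)
  have scale: "\<alpha> (rr (fps_const c) 0 \<odot>\<^bsub>N\<^esub> n) = fps_const c * \<alpha> n" if "n \<in> carrier N" for c n
    using P that by (intro fps_ext) (simp add: \<alpha>_def P_def semilinear_def)
  have y: "\<alpha> (rr fps_X 0 \<odot>\<^bsub>N\<^esub> n) = fps_X * \<alpha> n" if n: "n \<in> carrier N" for n
  proof (rule fps_ext)
    \<comment> \<open>At index 0 both sides vanish because \<phi> kills \<open>yN\<close>; the other
      indices are the defining property of \<open>S\<close>.\<close>
    show "\<alpha> (rr fps_X 0 \<odot>\<^bsub>N\<^esub> n) $ i = (fps_X * \<alpha> n) $ i" for i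
      using \<phi> n S(2)[OF P n] by (cases i) (simp_all add: \<alpha>_def \<Phi>_def residue_functional_def)
  qed
  \<comment> \<open>Commuting with constants and with \<open>y\<close> gives linearity only over
    polynomials. For a power series scalar, each coefficient is reached by splitting off the
    constant term and inducting on the index with the shifted scalar.\<close>
  have nth: "\<alpha> (rr a 0 \<odot>\<^bsub>N\<^esub> n) $ i = (a * \<alpha> n) $ i" if n: "n \<in> carrier N" for a n i
  proof (induction i arbitrary: a rule: less_induct)
    case (less i)
    define b where "b = fps_shift 1 a"
    have a: "a = fps_const (a $ 0) + fps_X * b"
      unfolding b_def by (rule fps_const_shift_decompose)
    have "rr a 0 \<odot>\<^bsub>N\<^esub> n = rr (fps_const (a $ 0)) 0 \<odot>\<^bsub>N\<^esub> n \<oplus>\<^bsub>N\<^esub> rr fps_X 0 \<odot>\<^bsub>N\<^esub> (rr b 0 \<odot>\<^bsub>N\<^esub> n)"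
      using n a by (simp add: rr_smult_add)
    then have "\<alpha> (rr a 0 \<odot>\<^bsub>N\<^esub> n) = fps_const (a $ 0) * \<alpha> n + fps_X * \<alpha> (rr b 0 \<odot>\<^bsub>N\<^esub> n)"
      using n by (simp add: add scale y del: rr_smult)
    moreover have "a * \<alpha> n = fps_const (a $ 0) * \<alpha> n + fps_X * (b * \<alpha> n)"
      by (subst a) (simp add: algebra_simps)
    moreover have "(fps_X * \<alpha> (rr b 0 \<odot>\<^bsub>N\<^esub> n)) $ i = (fps_X * (b * \<alpha> n)) $ i"
      using less[of "i - 1" b] by simp
    ultimately show ?case by simp
  qed
  show thesis
  proof
    show "semilinear id N_V \<alpha>" using add nth by (auto simp: semilinear_def intro: fps_ext)
    show "\<alpha> k = 0" if "k \<in> x_torsion" for k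
      using P that by (intro fps_ext) (simp add: \<alpha>_def P_def)
    show "\<alpha> n $ 0 = \<phi> n" if "n \<in> carrier N" for n by (simp add: \<alpha>_def \<Phi>_def)
  qed
qed

text \<open>For \<open>k[[y]]\<close>-linear \<alpha> and \<beta>, the map
  \<open>\<alpha> + x \<beta>\<close> is \<open>R\<close>-linear as soon as \<alpha> kills
  \<open>xN\<close> and \<open>\<beta> (x n) = \<alpha> n\<close>. The first holds because
  \<open>xN\<close> lies in \<open>K\<close>; the second is prescribed on \<open>xN\<close> and
  extended to \<open>N\<close>.\<close>

lemma R_tilde_lift:
  assumes \<phi>: "residue_functional \<phi>"
  obtains r where "r \<in> mod_hom R_ring N R_tilde"
    "\<And>n. n \<in> carrier N \<Longrightarrow> fls_nth (qfst (r n)) 0 = \<phi> n"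
proof -
  note tc = x_torsionD x_torsion_closed
  obtain \<alpha> where \<alpha>: "semilinear id N_V \<alpha>" "\<And>k. k \<in> x_torsion \<Longrightarrow> \<alpha> k = 0"
    "\<And>n. n \<in> carrier N \<Longrightarrow> \<alpha> n $ 0 = \<phi> n"
    using V_functional_lift[OF \<phi>] by blast
  have \<alpha>_add: "\<alpha> (m \<oplus>\<^bsub>N\<^esub> n) = \<alpha> m + \<alpha> n" if "m \<in> carrier N" "n \<in> carrier N" for m n
    using \<alpha>(1) that by (simp add: semilinear_def)
  have \<alpha>_scale: "\<alpha> (rr a 0 \<odot>\<^bsub>N\<^esub> n) = a * \<alpha> n" if "n \<in> carrier N" for a n
    using \<alpha>(1) that by (simp add: semilinear_def)
  define G where "G = {(rr 0 1 \<odot>\<^bsub>N\<^esub> n, fps_to_fls (\<alpha> n)) | n. n \<in> carrier N}"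
  have GI: "(rr 0 1 \<odot>\<^bsub>N\<^esub> n, fps_to_fls (\<alpha> n)) \<in> G" if "n \<in> carrier N" for n
    using that unfolding G_def by blast
  have GE: "\<exists>n. m = rr 0 1 \<odot>\<^bsub>N\<^esub> n \<and> b = fps_to_fls (\<alpha> n) \<and> n \<in> carrier N" if "(m, b) \<in> G" for m b
    using that unfolding G_def by blast
  have "semilinear_graph fps_to_fls N_V G"
    unfolding semilinear_graph_def
  proof (intro conjI allI impI)
    show "G \<noteq> {}" using GI[OF N.zero_closed] by blast
    show "m \<in> carrier N_V" if "(m, b) \<in> G" for m b using GE[OF that] by auto
    show "(m \<oplus>\<^bsub>N_V\<^esub> m', b + b') \<in> G" if mb: "(m, b) \<in> G" and mb': "(m', b') \<in> G" for m b m' b'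
    proof -
      obtain n where n: "m = rr 0 1 \<odot>\<^bsub>N\<^esub> n" "b = fps_to_fls (\<alpha> n)" "n \<in> carrier N"
        using GE[OF mb] by blast
      obtain n' where n': "m' = rr 0 1 \<odot>\<^bsub>N\<^esub> n'" "b' = fps_to_fls (\<alpha> n')" "n' \<in> carrier N"
        using GE[OF mb'] by blast
      show ?thesis using GI[of "n \<oplus>\<^bsub>N\<^esub> n'"] n n' by (simp add: \<alpha>_add N.smult_r_distr)
    qed
    show "(a \<odot>\<^bsub>N_V\<^esub> m, fps_to_fls a * b) \<in> G" if mb: "(m, b) \<in> G" for a m b
    proof -
      obtain n where n: "m = rr 0 1 \<odot>\<^bsub>N\<^esub> n" "b = fps_to_fls (\<alpha> n)" "n \<in> carrier N"
        using GE[OF mb] by blast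
      show ?thesis using GI[of "rr a 0 \<odot>\<^bsub>N\<^esub> n"] n by (simp add: \<alpha>_scale fls_times_fps_to_fls)
    qed
    show "b = 0" if zb: "(\<zero>\<^bsub>N_V\<^esub>, b) \<in> G" for b
    proof -
      obtain n where n: "\<zero>\<^bsub>N\<^esub> = rr 0 1 \<odot>\<^bsub>N\<^esub> n" "b = fps_to_fls (\<alpha> n)" "n \<in> carrier N"
        using GE[OF zb] by auto
      \<comment> \<open>Well-definedness on \<open>xN\<close>: if \<open>x n = 0\<close> then
        \<open>n\<close> is in \<open>K\<close>, and \<alpha> vanishes there.\<close>
      then have "n \<in> x_torsion" unfolding x_torsion_def by simp
      then show ?thesis using n(2) \<alpha>(2) by simp
    qed
  qed
  then obtain \<beta> where \<beta>: "semilinear fps_to_fls N_V \<beta>" "\<And>m b. (m, b) \<in> G \<Longrightarrow> \<beta> m = b"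
    by (rule semilinear_extend[OF N_V_module, rotated 4]) (auto simp: fls_times_fps_to_fls)
  have \<beta>_add: "\<beta> (m \<oplus>\<^bsub>N\<^esub> n) = \<beta> m + \<beta> n" if "m \<in> carrier N" "n \<in> carrier N" for m n
    using \<beta>(1) that by (simp add: semilinear_def)
  have \<beta>_scale: "\<beta> (rr a 0 \<odot>\<^bsub>N\<^esub> n) = fps_to_fls a * \<beta> n" if "n \<in> carrier N" for a n
    using \<beta>(1) that by (simp add: semilinear_def)
  have \<beta>_x: "\<beta> (rr 0 1 \<odot>\<^bsub>N\<^esub> n) = fps_to_fls (\<alpha> n)" if "n \<in> carrier N" for n
    using \<beta>(2) GI[OF that] by simp
  let ?r = "\<lambda>n \<in> carrier N. qq (fps_to_fls (\<alpha> n)) (\<beta> n)"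
  have "?r \<in> mod_hom R_ring N R_tilde"
  proof (rule mod_homI)
    fix s :: "'k rxy" and n assume "s \<in> carrier R_ring" and n: "n \<in> carrier N"
    then obtain a b where s: "s = rr a b" by (auto simp: R_carrier)
    have sn: "s \<odot>\<^bsub>N\<^esub> n = rr a 0 \<odot>\<^bsub>N\<^esub> n \<oplus>\<^bsub>N\<^esub> rr b 0 \<odot>\<^bsub>N\<^esub> (rr 0 1 \<odot>\<^bsub>N\<^esub> n)"
      using n by (simp add: s rr_smult_add)
    have "\<alpha> (s \<odot>\<^bsub>N\<^esub> n) = a * \<alpha> n"
      unfolding sn using n by (simp add: \<alpha>_add \<alpha>_scale \<alpha>(2) tc del: rr_smult)
    moreover have "\<beta> (s \<odot>\<^bsub>N\<^esub> n) = fps_to_fls a * \<beta> n + fps_to_fls b * fps_to_fls (\<alpha> n)"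
      unfolding sn using n by (simp add: \<beta>_add \<beta>_scale \<beta>_x del: rr_smult)
    ultimately show "qq (fps_to_fls (\<alpha> (s \<odot>\<^bsub>N\<^esub> n))) (\<beta> (s \<odot>\<^bsub>N\<^esub> n)) =
        s \<odot>\<^bsub>R_tilde\<^esub> qq (fps_to_fls (\<alpha> n)) (\<beta> n)"
      by (simp add: s fls_times_fps_to_fls)
  qed (auto simp: \<alpha>_add \<beta>_add N.module_axioms)
  then show thesis by (rule that) (simp add: \<alpha>(3))
qed

end

section \<open>The almost split sequence\<close>

text \<open>Since \<open>x\<close> kills both \<open>k\<close> and the generator of
  \<open>I_infty\<close>, sending \<open>e x\<close> to \<open>(e/d) k\<close> is
  \<open>R\<close>-linear, with \<open>1/d\<close> a power series; \<open>h\<close> takes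
  \<open>(e/d) k\<close> back to \<open>e x\<close>.\<close>

lemma I_infty_section:
  fixes N :: "('k::field rxy, 'n) module"
  assumes CM: "CM_module N" and h: "h \<in> mod_hom R_ring N I_infty"
    and k: "k \<in> x_torsion N" and hk: "h k = qq 0 (fps_to_fls d)" and d: "d $ 0 \<noteq> 0"
  shows "split_epi R_ring N I_infty h"
proof -
  interpret N: module R_ring N using CM by (rule CM_module_module)
  note rr_simps = rr_smult[OF CM] rr_smult_add[OF CM] x_torsionD[OF CM]
  have kN: "k \<in> carrier N" using k by (rule x_torsionD[OF CM])
  have x_k: "rr a b \<odot>\<^bsub>N\<^esub> k = rr a 0 \<odot>\<^bsub>N\<^esub> k" for a b
  proof -
    have "rr a b \<odot>\<^bsub>N\<^esub> k = rr a 0 \<odot>\<^bsub>N\<^esub> k \<oplus>\<^bsub>N\<^esub> rr b 0 \<odot>\<^bsub>N\<^esub> (rr 0 1 \<odot>\<^bsub>N\<^esub> k)"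
      using kN by (simp add: rr_simps)
    moreover have "rr 0 1 \<odot>\<^bsub>N\<^esub> k = \<zero>\<^bsub>N\<^esub>" using k by (simp add: x_torsion_def[OF CM])
    ultimately show ?thesis using kN by simp
  qed
  let ?s = "\<lambda>z \<in> carrier I_infty. rr (fls_regpart (qsnd z) * inverse d) 0 \<odot>\<^bsub>N\<^esub> k"
  have s: "?s \<in> mod_hom R_ring I_infty N"
  proof (rule mod_homI)
    fix r :: "'k rxy" and z :: "'k qxy" assume "r \<in> carrier R_ring" "z \<in> carrier I_infty"
    then obtain a b e where [simp]: "r = rr a b" "z = qq 0 (fps_to_fls e)"
      by (auto simp: R_carrier I_infty_carrier)
    show "rr (fls_regpart (qsnd (r \<odot>\<^bsub>I_infty\<^esub> z)) * inverse d) 0 \<odot>\<^bsub>N\<^esub> k =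
        r \<odot>\<^bsub>N\<^esub> (rr (fls_regpart (qsnd z) * inverse d) 0 \<odot>\<^bsub>N\<^esub> k)"
      using kN x_k[of "a * (e * inverse d)" "b * (e * inverse d)"]
      by (simp add: rr_simps mult.assoc flip: fls_times_fps_to_fls)
  next
    fix z w :: "'k qxy" assume "z \<in> carrier I_infty" "w \<in> carrier I_infty"
    then obtain e e' where [simp]: "z = qq 0 (fps_to_fls e)" "w = qq 0 (fps_to_fls e')"
      by (auto simp: I_infty_carrier)
    show "rr (fls_regpart (qsnd (z \<oplus>\<^bsub>I_infty\<^esub> w)) * inverse d) 0 \<odot>\<^bsub>N\<^esub> k =
        rr (fls_regpart (qsnd z) * inverse d) 0 \<odot>\<^bsub>N\<^esub> k \<oplus>\<^bsub>N\<^esub>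
        rr (fls_regpart (qsnd w) * inverse d) 0 \<odot>\<^bsub>N\<^esub> k"
      using kN by (simp add: rr_simps algebra_simps flip: fps_to_fls_plus)
  qed (use kN in \<open>auto simp: I_infty_module\<close>)
  have "h (?s z) = z" if z: "z \<in> carrier I_infty" for z
  proof -
    obtain e where e: "z = qq 0 (fps_to_fls e)" using z by (rule I_infty_cases)
    have "h (?s z) = rr (e * inverse d) 0 \<odot>\<^bsub>Q_module\<^esub> qq 0 (fps_to_fls d)"
      using z mod_homD(3)[OF h rr_closed kN] by (simp add: e hk)
    then show ?thesis using inverse_mult_eq_1[OF d] by (simp add: e mult.assoc flip: fls_times_fps_to_fls)
  qed
  then have "compose (carrier I_infty) h ?s = mod_id I_infty"
    by (auto simp: compose_def mod_id_def intro: restrict_ext)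
  then show ?thesis using h s unfolding split_epi_def by blast
qed

text \<open>The composite of \<open>h\<close> and \<open>r\<close> is multiplication by
  \<open>u + v x\<close> with \<open>u\<close> a unit; following \<open>r\<close> by the inverse
  multiplication gives the retraction.\<close>

lemma R_tilde_retraction:
  fixes h :: "'k::field qxy \<Rightarrow> 'n"
  assumes h: "h \<in> mod_hom R_ring R_tilde N" and r: "r \<in> mod_hom R_ring N R_tilde" and "CM_module N"
    and unit: "fls_nth (qfst (r (h (qq 1 0)))) 0 \<noteq> 0"
  shows "split_mono R_ring R_tilde N h"
proof -
  have N: "module R_ring N" using \<open>CM_module N\<close> by (rule CM_module_module)
  have "compose (carrier R_tilde) r h \<in> mod_hom R_ring R_tilde R_tilde"
    by (rule mod_hom_compose[OF r h R_tilde_module])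
  then obtain u v where uv: "compose (carrier R_tilde) r h =
      (\<lambda>z \<in> carrier R_tilde. z \<otimes>\<^bsub>Q_ring\<^esub> qq (fps_to_fls u) v)"
    by (rule R_tilde_endo)
  have rh: "r (h z) = z \<otimes>\<^bsub>Q_ring\<^esub> qq (fps_to_fls u) v" if "z \<in> carrier R_tilde" for z
    using fun_cong[OF uv, of z] that by (simp add: compose_def)
  have u: "u $ 0 \<noteq> 0" using unit by (simp add: rh)
  let ?g = "\<lambda>z \<in> carrier R_tilde. z \<otimes>\<^bsub>Q_ring\<^esub>
    qq (fps_to_fls (inverse u)) (- v * fps_to_fls (inverse u) * fps_to_fls (inverse u))"
  have "?g (r (h z)) = z" if z: "z \<in> carrier R_tilde" for z
  proof -
    have "r (h z) \<in> carrier R_tilde" using z h r by (simp add: mod_homD)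
    moreover obtain a d where "z = qq (fps_to_fls a) d" using z by (rule R_tilde_cases)
    ultimately show ?thesis using z qq_mult_inverse(1)[OF u] by (simp add: rh del: qq_mult)
  qed
  then have "compose (carrier R_tilde) (compose (carrier N) ?g r) h = mod_id R_tilde"
    using h by (auto simp: compose_def mod_id_def mod_homD intro: restrict_ext)
  moreover have "compose (carrier N) ?g r \<in> mod_hom R_ring N R_tilde"
    by (rule mod_hom_compose[OF R_tilde_mult_endo r N])
  ultimately show ?thesis using h unfolding split_mono_def by blast
qed

section \<open>The two maps of the sequence, exactness and non-splitness\<close>

definition AR_left :: "'k::field qxy \<Rightarrow> 'k qxy \<times> 'k qxy" where
  "AR_left = (\<lambda>z \<in> carrier R_tilde. (R_y \<odot>\<^bsub>Q_module\<^esub> z, R_x \<odot>\<^bsub>Q_module\<^esub> z))"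

definition AR_right :: "'k::field qxy \<times> 'k qxy \<Rightarrow> 'k qxy" where
  "AR_right = (\<lambda>(z, w) \<in> carrier (direct_sum R_tilde I_infty).
     (R_x \<odot>\<^bsub>Q_module\<^esub> z) \<oplus>\<^bsub>Q_module\<^esub> ((\<ominus>\<^bsub>R_ring\<^esub> R_y) \<odot>\<^bsub>Q_module\<^esub> w))"

lemma AR_left_qq [simp]:
  "AR_left (qq (fps_to_fls a) d) = (qq (fls_X * fps_to_fls a) (fls_X * d), qq 0 (fps_to_fls a))"
  by (simp add: AR_left_def R_x_eq R_y_eq)

lemma AR_right_qq [simp]:
  "AR_right (qq (fps_to_fls a) d, qq 0 (fps_to_fls e)) = qq 0 (fps_to_fls (a - fps_X * e))"
  by (simp add: AR_right_def R_x_eq R_y_eq fls_times_fps_to_fls)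

lemma fls_X_times_mem [simp]: "qq (fls_X * fps_to_fls a) d \<in> carrier R_tilde"
  using R_tilde_mem[of "fps_X * a" d] by (simp add: fls_times_fps_to_fls)

lemma AR_left_hom: "AR_left \<in> mod_hom R_ring R_tilde (direct_sum R_tilde I_infty)"
  unfolding AR_left_def
proof (rule mod_homI)
  show "(R_y \<odot>\<^bsub>Q_module\<^esub> z, R_x \<odot>\<^bsub>Q_module\<^esub> z) \<in> carrier (direct_sum R_tilde I_infty)"
    if z: "z \<in> carrier R_tilde" for z
  proof -
    obtain a d where "z = qq (fps_to_fls a) d" using z by (rule R_tilde_cases)
    then show ?thesis by (simp add: R_x_eq R_y_eq)
  qed
qed (auto simp: R_tilde_module R_tilde_carrier R_carrier R_x_eq R_y_eq fls_times_fps_to_fls algebra_simps)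

lemma AR_right_hom: "AR_right \<in> mod_hom R_ring (direct_sum R_tilde I_infty) I_infty"
  unfolding AR_right_def
proof (rule mod_homI)
  show "(case p of (z, w) \<Rightarrow> (R_x \<odot>\<^bsub>Q_module\<^esub> z) \<oplus>\<^bsub>Q_module\<^esub> ((\<ominus>\<^bsub>R_ring\<^esub> R_y) \<odot>\<^bsub>Q_module\<^esub> w))
      \<in> carrier I_infty" if p: "p \<in> carrier (direct_sum R_tilde I_infty)" for p
  proof -
    obtain a d e where "p = (qq (fps_to_fls a) d, qq 0 (fps_to_fls e))"
      using p by (auto simp: R_tilde_carrier I_infty_carrier)
    then show ?thesis using I_infty_mem[of "a - fps_X * e"]
      by (simp add: R_x_eq R_y_eq fls_times_fps_to_fls)
  qed
qed (auto simp: direct_sum_module R_tilde_module I_infty_module R_tilde_carrier I_infty_carrier R_carrier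
    R_x_eq R_y_eq algebra_simps)

lemma AR_short_exact:
  "short_exact R_ring R_tilde AR_left (direct_sum R_tilde I_infty) AR_right (I_infty :: ('k::field rxy, 'k qxy) module)"
  unfolding short_exact_def
proof (intro conjI AR_left_hom AR_right_hom)
  show "inj_on AR_left (carrier (R_tilde :: ('k rxy, 'k qxy) module))"
    by (auto simp: inj_on_def R_tilde_carrier)
  show "AR_left ` carrier R_tilde = a_kernel (direct_sum R_tilde I_infty) (I_infty :: ('k rxy, 'k qxy) module) AR_right"
  proof (intro equalityI subsetI)
    fix p :: "'k qxy \<times> 'k qxy"
    assume "p \<in> AR_left ` carrier R_tilde"
    then obtain a d where p: "p = (qq (fls_X * fps_to_fls a) (fls_X * d), qq 0 (fps_to_fls a))"
      by (auto simp: R_tilde_carrier)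
    then show "p \<in> a_kernel (direct_sum R_tilde I_infty) I_infty AR_right"
      using AR_right_qq[of "fps_X * a" "fls_X * d" a]
      by (simp add: a_kernel_def kernel_def fls_times_fps_to_fls)
  next
    fix p :: "'k qxy \<times> 'k qxy"
    assume "p \<in> a_kernel (direct_sum R_tilde I_infty) I_infty AR_right"
    then have "p \<in> carrier R_tilde \<times> carrier I_infty" "AR_right p = qq 0 0"
      by (simp_all add: a_kernel_def kernel_def)
    then obtain a d e where p: "p = (qq (fps_to_fls a) d, qq 0 (fps_to_fls e))" "a - fps_X * e = 0"
      by (auto simp: R_tilde_carrier I_infty_carrier fls_times_fps_to_fls)
    \<comment> \<open>A kernel element has \<open>a = y e\<close>, while \<open>d\<close> is a
      Laurent series and can always be divided by \<open>y\<close>.\<close>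
    then have "p = AR_left (qq (fps_to_fls e) (d / fls_X))"
      by (simp add: fls_times_fps_to_fls)
    moreover have "qq (fps_to_fls e) (d / fls_X) \<in> carrier R_tilde" by simp
    ultimately show "p \<in> AR_left ` carrier R_tilde" by (rule image_eqI)
  qed
  show "AR_right ` carrier (direct_sum R_tilde I_infty) = carrier (I_infty :: ('k rxy, 'k qxy) module)"
  proof (intro equalityI subsetI)
    fix w :: "'k qxy" assume "w \<in> carrier I_infty"
    then obtain e where "w = qq 0 (fps_to_fls e)" by (rule I_infty_cases)
    \<comment> \<open>The first summand alone already maps onto \<open>I_infty\<close>.\<close>
    then have "w = AR_right (qq (fps_to_fls e) 0, qq 0 (fps_to_fls 0))" by (simp only: AR_right_qq) simp
    moreover have "(qq (fps_to_fls e) 0, qq 0 (fps_to_fls 0)) \<in> carrier (direct_sum R_tilde I_infty)"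
      by (simp only: direct_sum_simps mem_Times_iff) (simp only: fst_conv snd_conv R_tilde_mem I_infty_mem)
    ultimately show "w \<in> AR_right ` carrier (direct_sum R_tilde I_infty)" by (rule image_eqI)
  qed (use mod_homD(1)[OF AR_right_hom] in blast)
qed

text \<open>A section would send the generator \<open>x\<close> to an element killed by
  \<open>x\<close>, whose first component lies in \<open>xL\<close> and is mapped to 0. What remains
  is a multiple of \<open>y x\<close>, which cannot be \<open>x\<close>.\<close>

lemma AR_right_not_split:
  "\<not> split_epi R_ring (direct_sum R_tilde I_infty) (I_infty :: ('k::field rxy, 'k qxy) module) AR_right"
proof
  assume "split_epi R_ring (direct_sum R_tilde I_infty) (I_infty :: ('k rxy, 'k qxy) module) AR_right"
  then obtain s where s: "s \<in> mod_hom R_ring I_infty (direct_sum R_tilde I_infty)"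
    and id: "compose (carrier I_infty) AR_right s = mod_id (I_infty :: ('k rxy, 'k qxy) module)"
    by (auto simp: split_epi_def)
  have "s (qq 0 1) \<in> carrier R_tilde \<times> carrier I_infty"
    using mod_homD(1)[OF s I_infty_mem_0_1(2)] by simp
  then obtain a d e where ade: "s (qq 0 1) = (qq (fps_to_fls a) d, qq 0 (fps_to_fls e))"
    by (auto simp: R_tilde_carrier I_infty_carrier)
  have "rr 0 1 \<odot>\<^bsub>I_infty\<^esub> qq 0 1 = rr 0 0 \<odot>\<^bsub>I_infty\<^esub> (qq 0 1 :: 'k qxy)" by simp
  then have "rr 0 1 \<odot>\<^bsub>direct_sum R_tilde I_infty\<^esub> s (qq 0 1) =
      rr 0 0 \<odot>\<^bsub>direct_sum R_tilde I_infty\<^esub> s (qq 0 1)"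
    by (metis mod_homD(3)[OF s] rr_closed I_infty_mem_0_1(2))
  then have "a = 0" by (simp add: ade)
  moreover have "AR_right (s (qq 0 1)) = qq 0 1"
    using fun_cong[OF id, of "qq 0 1"] by (simp add: compose_def mod_id_def)
  ultimately have "fps_to_fls (- (fps_X * e)) = fps_to_fls 1"
    unfolding ade AR_right_qq by simp
  then have "- (fps_X * e) = 1" by (simp only: fps_to_fls_eq_iff)
  then have "(- (fps_X * e)) $ 0 = 1" by simp
  then show False by simp
qed

section \<open>The two factorization properties\<close>

lemma AR_right_almost_split:
  "right_almost_split TYPE('n) (direct_sum R_tilde I_infty) (I_infty :: ('k::field rxy, 'k qxy) module) AR_right"
  unfolding right_almost_split_def
proof (intro allI impI ballI)
  fix N :: "('k rxy, 'n) module" and h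
  assume CM: "CM_module N" and h: "h \<in> mod_hom R_ring N (I_infty :: ('k rxy, 'k qxy) module)"
    and not_split: "\<not> split_epi R_ring N I_infty h"
  interpret N: module R_ring N using CM by (rule CM_module_module)
  \<comment> \<open>\<open>D\<close> is \<open>h/x\<close>, so that
    \<open>h n = x D n\<close>.\<close>
  define D where "D n = fls_regpart (qsnd (h n))" for n
  have hD: "h n = qq 0 (fps_to_fls (D n))" if n: "n \<in> carrier N" for n
  proof -
    obtain d where "h n = qq 0 (fps_to_fls d)" using mod_homD(1)[OF h n] by (rule I_infty_cases)
    then show ?thesis by (simp add: D_def)
  qed
  have D_add: "D (m \<oplus>\<^bsub>N\<^esub> n) = D m + D n" if "m \<in> carrier N" "n \<in> carrier N" for m n
    using mod_homD(2)[OF h that] that by (simp add: hD flip: fps_to_fls_plus)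
  have D_scale: "D (rr a b \<odot>\<^bsub>N\<^esub> n) = a * D n" if "n \<in> carrier N" for a b n
    using mod_homD(3)[OF h rr_closed that, of a b] that by (simp add: hD flip: fls_times_fps_to_fls)
  have res: "residue_functional N (\<lambda>n. D n $ 0)"
    unfolding residue_functional_def[OF CM]
  proof (intro conjI ballI allI)
    fix k assume k: "k \<in> x_torsion N"
    \<comment> \<open>A nonzero residue at an element of \<open>K\<close> would split
      \<open>h\<close> by \<open>I_infty_section\<close>.\<close>
    then show "D k $ 0 = 0"
      using I_infty_section[OF CM h k hD] x_torsionD[OF CM] not_split by blast
  qed (simp_all add: D_add D_scale)
  obtain r where r: "r \<in> mod_hom R_ring N R_tilde"
    "\<And>n. n \<in> carrier N \<Longrightarrow> fls_nth (qfst (r n)) 0 = D n $ 0"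
    using R_tilde_lift[OF CM res] by blast
  define A where "A n = fls_regpart (qfst (r n))" for n
  have rA: "r n = qq (fps_to_fls (A n)) (qsnd (r n))" if n: "n \<in> carrier N" for n
  proof -
    obtain a d where "r n = qq (fps_to_fls a) d" using mod_homD(1)[OF r(1) n] by (rule R_tilde_cases)
    then show ?thesis by (simp add: A_def)
  qed
  have A_add: "A (m \<oplus>\<^bsub>N\<^esub> n) = A m + A n" if "m \<in> carrier N" "n \<in> carrier N" for m n
  proof -
    have "qfst (r (m \<oplus>\<^bsub>N\<^esub> n)) = qfst (qq (fps_to_fls (A m)) (qsnd (r m)) \<oplus>\<^bsub>Q_module\<^esub> qq (fps_to_fls (A n)) (qsnd (r n)))"
      using mod_homD(2)[OF r(1) that] rA that by simp
    then show ?thesis by (simp add: A_def flip: fps_to_fls_plus)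
  qed
  have A_scale: "A (rr a b \<odot>\<^bsub>N\<^esub> n) = a * A n" if "n \<in> carrier N" for a b n
  proof -
    have "qfst (r (rr a b \<odot>\<^bsub>N\<^esub> n)) = qfst (rr a b \<odot>\<^bsub>Q_module\<^esub> qq (fps_to_fls (A n)) (qsnd (r n)))"
      using mod_homD(3)[OF r(1) rr_closed that, of a b] rA that by simp
    then show ?thesis by (simp add: A_def flip: fls_times_fps_to_fls)
  qed
  \<comment> \<open>\<open>A\<close> and \<open>D\<close> have equal residues, so their difference
    is divisible by \<open>y\<close>. With this sign \<open>x A - y (x T) = x D = h\<close>,
    matching the map \<open>(x, -y)\<close>.\<close>
  define T where "T n = fps_shift 1 (A n - D n)" for n
  have T: "fps_X * T n = A n - D n" if n: "n \<in> carrier N" for n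
  proof -
    have "(A n - D n) $ 0 = 0" using r(2)[OF n] arg_cong[OF rA[OF n], of qfst] by simp
    then show ?thesis using fps_const_shift_decompose[of "A n - D n"] by (simp add: T_def)
  qed
  have T_add: "T (m \<oplus>\<^bsub>N\<^esub> n) = T m + T n" if "m \<in> carrier N" "n \<in> carrier N" for m n
  proof -
    \<comment> \<open>Additivity is verified after multiplication by \<open>y\<close> and then
      cancelled.\<close>
    have "fps_X * T (m \<oplus>\<^bsub>N\<^esub> n) = fps_X * (T m + T n)"
      using that by (simp add: T distrib_left A_add D_add)
    then show ?thesis by simp
  qed
  have T_scale: "T (rr a b \<odot>\<^bsub>N\<^esub> n) = a * T n" if "n \<in> carrier N" for a b n
  proof -
    have "fps_X * T (rr a b \<odot>\<^bsub>N\<^esub> n) = a * (fps_X * T n)"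
      using that by (simp add: T A_scale D_scale right_diff_distrib)
    then show ?thesis by (simp add: mult.left_commute)
  qed
  let ?u = "\<lambda>n \<in> carrier N. (r n, qq 0 (fps_to_fls (T n)))"
  have "?u \<in> mod_hom R_ring N (direct_sum R_tilde I_infty)"
    by (rule mod_homI)
      (auto simp: mod_homD[OF r(1)] T_add T_scale R_carrier fls_times_fps_to_fls N.module_axioms)
  moreover have "AR_right (?u n) = h n" if n: "n \<in> carrier N" for n
  proof -
    have "AR_right (?u n) = AR_right (qq (fps_to_fls (A n)) (qsnd (r n)), qq 0 (fps_to_fls (T n)))"
      using n rA[OF n] by simp
    also have "\<dots> = h n" unfolding AR_right_qq T[OF n] by (simp add: hD[OF n])
    finally show ?thesis .
  qed
  then have "h = compose (carrier N) AR_right ?u"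
    by (intro extensionalityI[OF mod_homD(4)[OF h]]) (auto simp: compose_def)
  ultimately show "\<exists>u \<in> mod_hom R_ring N (direct_sum R_tilde I_infty). h = compose (carrier N) AR_right u"
    by blast
qed

lemma AR_left_almost_split:
  "left_almost_split TYPE('n) (R_tilde :: ('k::field rxy, 'k qxy) module) (direct_sum R_tilde I_infty) AR_left"
  unfolding left_almost_split_def
proof (intro allI impI ballI)
  fix N :: "('k rxy, 'n) module" and h
  assume CM: "CM_module N" and h: "h \<in> mod_hom R_ring (R_tilde :: ('k rxy, 'k qxy) module) N"
    and not_split: "\<not> split_mono R_ring R_tilde N h"
  interpret N: module R_ring N using CM by (rule CM_module_module)
  note rr_simps = rr_smult[OF CM] rr_smult_add[OF CM] x_torsionD[OF CM]
  define n0 where "n0 = h (qq 1 0)"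
  have n0: "n0 \<in> carrier N" using mod_homD(1)[OF h] by (simp add: n0_def)
  \<comment> \<open>Otherwise a functional with value 1 at \<open>n0\<close> lifts to some
    \<open>r\<close> for which \<open>r (h 1)\<close> has residue 1, and \<open>h\<close> would be a
    split monomorphism.\<close>
  have "\<exists>k n. k \<in> x_torsion N \<and> n \<in> carrier N \<and> n0 = k \<oplus>\<^bsub>N\<^esub> rr fps_X 0 \<odot>\<^bsub>N\<^esub> n"
  proof (rule ccontr)
    assume "\<not> ?thesis"
    then obtain \<phi> where "residue_functional N \<phi>" "\<phi> n0 = 1"
      using residue_functional_exists[OF CM n0] by blast
    then obtain r where r: "r \<in> mod_hom R_ring N R_tilde" and "fls_nth (qfst (r n0)) 0 = 1"
      using R_tilde_lift[OF CM] n0 by metis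
    then show False using R_tilde_retraction[OF h r CM] not_split by (simp add: n0_def)
  qed
  then obtain k n where k: "k \<in> x_torsion N" and n: "n \<in> carrier N"
    and n0_eq: "n0 = k \<oplus>\<^bsub>N\<^esub> rr fps_X 0 \<odot>\<^bsub>N\<^esub> n" by blast
  have kN: "k \<in> carrier N" using k by (simp add: rr_simps)
  have xk: "rr 0 1 \<odot>\<^bsub>N\<^esub> k = \<zero>\<^bsub>N\<^esub>" using k by (simp add: x_torsion_def[OF CM])
  \<comment> \<open>The restriction of \<open>h\<close> to \<open>xL\<close>, indexed by the
    coefficient of \<open>x\<close>; unlike elements of \<open>N\<close> in general, its values can
    be divided by \<open>y\<close> inside the image.\<close>
  define H where "H c = h (qq 0 c)" for c
  have H: "H c \<in> carrier N" for c using mod_homD(1)[OF h] by (simp add: H_def)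
  have H_add: "H (c + d) = H c \<oplus>\<^bsub>N\<^esub> H d" for c d
    using mod_homD(2)[OF h, of "qq 0 c" "qq 0 d"] by (simp add: H_def)
  have H_scale: "rr a b \<odot>\<^bsub>N\<^esub> H c = H (fps_to_fls a * c)" for a b c
    using mod_homD(3)[OF h, of "rr a b" "qq 0 c"] by (simp add: H_def)
  have x_n0: "rr 0 a \<odot>\<^bsub>N\<^esub> n0 = H (fps_to_fls a)" for a
    using mod_homD(3)[OF h, of "rr 0 a" "qq 1 0"] by (simp add: H_def n0_def)
  \<comment> \<open>Compatibility of the first two terms of \<open>v\<close>. Both sides give
    \<open>h x\<close> when multiplied by \<open>y\<close>, the left one because
    \<open>x k = 0\<close>, and \<open>y\<close> cancels in a CM-module.\<close>
  have x_n: "rr 0 1 \<odot>\<^bsub>N\<^esub> n = H (1 / fls_X)"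
  proof -
    have "rr fps_X 0 \<odot>\<^bsub>N\<^esub> (rr 0 1 \<odot>\<^bsub>N\<^esub> n) = rr 0 1 \<odot>\<^bsub>N\<^esub> n0"
      using n kN xk by (simp add: n0_eq N.smult_r_distr rr_simps)
    also have "\<dots> = rr fps_X 0 \<odot>\<^bsub>N\<^esub> H (1 / fls_X)" using x_n0[of 1] by (simp add: H_scale)
    finally have y: "rr fps_X 0 \<odot>\<^bsub>N\<^esub> (rr 0 1 \<odot>\<^bsub>N\<^esub> n \<ominus>\<^bsub>N\<^esub> H (1 / fls_X)) = \<zero>\<^bsub>N\<^esub>"
      using n H by (simp add: a_minus_def N.smult_r_distr N.smult_r_minus N.M.r_neg del: rr_smult)
    have "rr 0 1 \<odot>\<^bsub>N\<^esub> n \<ominus>\<^bsub>N\<^esub> H (1 / fls_X) = \<zero>\<^bsub>N\<^esub>"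
      by (rule y_smult_cancel[OF CM _ y]) (simp add: n H)
    then have "\<ominus>\<^bsub>N\<^esub> (\<ominus>\<^bsub>N\<^esub> H (1 / fls_X)) = rr 0 1 \<odot>\<^bsub>N\<^esub> n"
      using n H by (intro N.M.minus_equality) (simp_all add: a_minus_def)
    then show ?thesis using H by simp
  qed
  \<comment> \<open>The scalar \<open>a + b x\<close> acts on \<open>k\<close> through
    \<open>a\<close> alone, just as on \<open>I_infty\<close>.\<close>
  have x_k: "rr a b \<odot>\<^bsub>N\<^esub> k = rr a 0 \<odot>\<^bsub>N\<^esub> k" for a b
  proof -
    have "rr a b \<odot>\<^bsub>N\<^esub> k = rr a 0 \<odot>\<^bsub>N\<^esub> k \<oplus>\<^bsub>N\<^esub> rr b 0 \<odot>\<^bsub>N\<^esub> (rr 0 1 \<odot>\<^bsub>N\<^esub> k)"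
      using kN by (simp add: rr_simps)
    then show ?thesis using kN by (simp add: xk del: rr_smult)
  qed
  have x_n': "rr a b \<odot>\<^bsub>N\<^esub> n = rr a 0 \<odot>\<^bsub>N\<^esub> n \<oplus>\<^bsub>N\<^esub> H (fps_to_fls b / fls_X)" for a b
  proof -
    have "rr a b \<odot>\<^bsub>N\<^esub> n = rr a 0 \<odot>\<^bsub>N\<^esub> n \<oplus>\<^bsub>N\<^esub> rr b 0 \<odot>\<^bsub>N\<^esub> (rr 0 1 \<odot>\<^bsub>N\<^esub> n)"
      using n by (simp add: rr_simps)
    then show ?thesis by (simp add: x_n H_scale del: rr_smult)
  qed
  \<comment> \<open>On \<open>(a + d x, e x)\<close> this is \<open>a n + h (d x / y) + e k\<close>.
    Applied to \<open>(y z, x z)\<close>, the outer terms reassemble to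
    \<open>a (k + y n) = a n0\<close> and the middle one to \<open>h (d x)\<close>.\<close>
  define v where "v p = (case p of (z, w) \<Rightarrow> rr (fls_regpart (qfst z)) 0 \<odot>\<^bsub>N\<^esub> n \<oplus>\<^bsub>N\<^esub>
    H (qsnd z / fls_X) \<oplus>\<^bsub>N\<^esub> rr (fls_regpart (qsnd w)) 0 \<odot>\<^bsub>N\<^esub> k)" for p
  have v_qq: "v (qq (fps_to_fls a) d, qq 0 (fps_to_fls e)) =
      rr a 0 \<odot>\<^bsub>N\<^esub> n \<oplus>\<^bsub>N\<^esub> H (d / fls_X) \<oplus>\<^bsub>N\<^esub> rr e 0 \<odot>\<^bsub>N\<^esub> k" for a d e
    by (simp add: v_def)
  let ?u = "\<lambda>p \<in> carrier (direct_sum R_tilde I_infty). v p"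
  have "?u \<in> mod_hom R_ring (direct_sum R_tilde I_infty) N"
  proof (rule mod_homI)
    show "v p \<in> carrier N" if "p \<in> carrier (direct_sum R_tilde I_infty)" for p
      using n kN H by (auto simp: v_def split: prod.split)
  next
    fix p q :: "'k qxy \<times> 'k qxy"
    assume "p \<in> carrier (direct_sum R_tilde I_infty)" "q \<in> carrier (direct_sum R_tilde I_infty)"
    then obtain a d e a' d' e' where pq: "p = (qq (fps_to_fls a) d, qq 0 (fps_to_fls e))"
      "q = (qq (fps_to_fls a') d', qq 0 (fps_to_fls e'))"
      by (auto simp: R_tilde_carrier I_infty_carrier)
    then have sum: "p \<oplus>\<^bsub>direct_sum R_tilde I_infty\<^esub> q =
        (qq (fps_to_fls (a + a')) (d + d'), qq 0 (fps_to_fls (e + e')))" by simp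
    have "rr (a + a') 0 \<odot>\<^bsub>N\<^esub> n = rr a 0 \<odot>\<^bsub>N\<^esub> n \<oplus>\<^bsub>N\<^esub> rr a' 0 \<odot>\<^bsub>N\<^esub> n"
      "rr (e + e') 0 \<odot>\<^bsub>N\<^esub> k = rr e 0 \<odot>\<^bsub>N\<^esub> k \<oplus>\<^bsub>N\<^esub> rr e' 0 \<odot>\<^bsub>N\<^esub> k"
      using n kN by (simp_all add: rr_simps)
    then show "v (p \<oplus>\<^bsub>direct_sum R_tilde I_infty\<^esub> q) = v p \<oplus>\<^bsub>N\<^esub> v q"
      unfolding sum unfolding pq v_qq using n kN H by (simp add: H_add add_divide_distrib N.M.a_ac)
  next
    fix s :: "'k rxy" and p :: "'k qxy \<times> 'k qxy"
    assume "s \<in> carrier R_ring" "p \<in> carrier (direct_sum R_tilde I_infty)"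
    then obtain b c a d e where s: "s = rr b c" and p: "p = (qq (fps_to_fls a) d, qq 0 (fps_to_fls e))"
      by (auto simp: R_tilde_carrier I_infty_carrier R_carrier)
    then have sp: "s \<odot>\<^bsub>direct_sum R_tilde I_infty\<^esub> p =
        (qq (fps_to_fls (b * a)) (fps_to_fls b * d + fps_to_fls (c * a)), qq 0 (fps_to_fls (b * e)))"
      by (simp add: fls_times_fps_to_fls)
    have "s \<odot>\<^bsub>N\<^esub> v p = rr (b * a) (c * a) \<odot>\<^bsub>N\<^esub> n \<oplus>\<^bsub>N\<^esub> H (fps_to_fls b * d / fls_X) \<oplus>\<^bsub>N\<^esub>
        rr (b * e) (c * e) \<odot>\<^bsub>N\<^esub> k"
      unfolding s p v_qq using n kN H by (simp add: N.smult_r_distr H_scale rr_simps)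
    also have "\<dots> = v (s \<odot>\<^bsub>direct_sum R_tilde I_infty\<^esub> p)"
      unfolding sp unfolding v_qq x_n'[of "b * a" "c * a"] x_k[of "b * e" "c * e"] using n kN H
      by (simp add: H_add add_divide_distrib N.M.a_ac)
    finally show "v (s \<odot>\<^bsub>direct_sum R_tilde I_infty\<^esub> p) = s \<odot>\<^bsub>N\<^esub> v p" ..
  qed (simp add: direct_sum_module R_tilde_module I_infty_module)
  moreover have "?u (AR_left z) = h z" if z: "z \<in> carrier R_tilde" for z
  proof -
    obtain a d where ad: "z = qq (fps_to_fls a) d" using z by (rule R_tilde_cases)
    have "?u (AR_left z) = v (qq (fps_to_fls (fps_X * a)) (fls_X * d), qq 0 (fps_to_fls a))"
      by (simp add: ad fls_times_fps_to_fls)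
    also have "\<dots> = rr a 0 \<odot>\<^bsub>N\<^esub> n0 \<oplus>\<^bsub>N\<^esub> H d"
      unfolding v_qq n0_eq using n kN H by (simp add: N.smult_r_distr rr_simps N.M.a_ac mult.commute)
    also have "rr a 0 \<odot>\<^bsub>N\<^esub> n0 = h (qq (fps_to_fls a) 0)"
      using mod_homD(3)[OF h, of "rr a 0" "qq 1 0"] by (simp add: n0_def)
    also have "h (qq (fps_to_fls a) 0) \<oplus>\<^bsub>N\<^esub> H d = h z"
      using mod_homD(2)[OF h, of "qq (fps_to_fls a) 0" "qq 0 d"] by (simp add: H_def ad)
    finally show ?thesis .
  qed
  then have "h = compose (carrier R_tilde) ?u AR_left"
    by (intro extensionalityI[OF mod_homD(4)[OF h]]) (auto simp: compose_def)
  ultimately show "\<exists>u \<in> mod_hom R_ring (direct_sum R_tilde I_infty) N. h = compose (carrier R_tilde) u AR_left"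
    by blast
qed

theorem proposition7p2:
  assumes "CHAR('k::alg_closed_field) \<noteq> 2"
  shows "AR_sequence TYPE('n)
           (R_tilde :: ('k rxy, 'k qxy) module)
           (\<lambda>a \<in> carrier R_tilde. (R_y \<odot>\<^bsub>Q_module\<^esub> a, R_x \<odot>\<^bsub>Q_module\<^esub> a))
           (direct_sum R_tilde I_infty)
           (\<lambda>(a, b) \<in> carrier (direct_sum R_tilde I_infty).
              (R_x \<odot>\<^bsub>Q_module\<^esub> a) \<oplus>\<^bsub>Q_module\<^esub> ((\<ominus>\<^bsub>R_ring\<^esub> R_y) \<odot>\<^bsub>Q_module\<^esub> b))
           I_infty"
  unfolding AR_left_def[symmetric] AR_right_def[symmetric] AR_sequence_def
  by (intro conjI R_tilde_CM I_infty_CM direct_sum_CM AR_short_exact AR_right_not_split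
      End_R_tilde_local End_I_infty_local AR_left_almost_split AR_right_almost_split)

end
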